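(* Let $f:\mathbb{R}^d\to\mathbb{R}$ be a measurable function such that $e^{f}\in L^1(\gamma)$ and $f\in L^1(\gamma)$, where $\gamma$ is the standard Gaussian measure on $\mathbb{R}^d$. Then $$t\log\mathbb{E}\left[\exp\left\{t^{-1}\,\mathbb{E}\left[f(B_1)\mid\mathcal{F}^{B}_{t}\right]\right\}\right]\le\log\mathbb{E}\left[e^{f(B_1)}\right]$$ for all $0<t\le1$.
   Context: $d$ is a positive integer. $B=\{B_t\}_{t\ge0}$ is a standard $d$-dimensional Brownian motion (started at the origin) on a probability space with probability measure $\mathbb{P}$ and expectation $\mathbb{E}$. $\mathcal{F}^{B}_{t}:=\sigma(B_s,0\le s\le t)\vee\mathcal{N}$ for $t\ge0$, where $\mathcal{N}$ is the set of all $\mathbb{P}$-null events. $\mathbb{E}[\,\cdot\mid\mathcal{F}^B_t]$ is conditional expectation. *)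

theory Defs
  imports "HOL-Probability.Probability"
begin

definition std_gaussian :: "(real ^ 'd::finite) measure" where
  "std_gaussian =
     density lborel
       (\<lambda>x. ennreal ((2 * pi) powr (- real CARD('d) / 2) * exp (- (norm x)\<^sup>2 / 2)))"

text \<open>Only the values \<^term>\<open>B t\<close> with \<^term>\<open>0 \<le> t\<close> matter; nothing is required of \<^term>\<open>B t\<close>
  for negative \<^term>\<open>t\<close>. The law of the increment over \<open>[s, t]\<close> is
  the centred Gaussian with covariance \<open>t - s\<close> times the identity, expressed as the image of
  the standard Gaussian under scaling by \<open>sqrt (t - s)\<close>.\<close>

locale standard_brownian_motion = prob_space M
  for M :: "'w measure" and B :: "real \<Rightarrow> 'w \<Rightarrow> real ^ 'd::finite" +
  assumes measurable_B: "\<And>t. 0 \<le> t \<Longrightarrow> B t \<in> borel_measurable M"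
    and start_origin: "AE \<omega> in M. B 0 \<omega> = 0"
    and indep_increments:
      "\<And>(n::nat) (\<tau>::nat \<Rightarrow> real).
         0 \<le> \<tau> 0 \<Longrightarrow> (\<And>i. i < n \<Longrightarrow> \<tau> i < \<tau> (Suc i)) \<Longrightarrow>
         indep_vars (\<lambda>_. borel) (\<lambda>i \<omega>. B (\<tau> (Suc i)) \<omega> - B (\<tau> i) \<omega>) {..<n}"
    and gaussian_increments:
      "\<And>s t. 0 \<le> s \<Longrightarrow> s < t \<Longrightarrow>
         distr M borel (\<lambda>\<omega>. B t \<omega> - B s \<omega>) = distr std_gaussian borel (\<lambda>x. sqrt (t - s) *\<^sub>R x)"
    and continuous_paths: "AE \<omega> in M. continuous_on {0..} (\<lambda>t. B t \<omega>)"

text \<open>A sigma-algebra is represented, as for \<^const>\<open>real_cond_exp\<close>, by a measure of which only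
  the space and the measurable sets are relevant.\<close>

definition augmented_filtration ::
  "'w measure \<Rightarrow> (real \<Rightarrow> 'w \<Rightarrow> real ^ 'd::finite) \<Rightarrow> real \<Rightarrow> 'w measure" where
  "augmented_filtration M B t =
     sigma (space M)
       ({B s -` A \<inter> space M | s A. 0 \<le> s \<and> s \<le> t \<and> A \<in> sets borel} \<union> null_sets M)"

lemma (in standard_brownian_motion) subalgebra_augmented_filtration:
  "subalgebra M (augmented_filtration M B t)"
proof -
  let ?G = "{B s -` A \<inter> space M | s A. 0 \<le> s \<and> s \<le> t \<and> A \<in> sets borel} \<union> null_sets M"
  have "?G \<subseteq> sets M"
    using measurable_B by (auto intro: measurable_sets)
  moreover from this have "?G \<subseteq> Pow (space M)"
    using sets.sets_into_space by blast
  ultimately show ?thesis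
    unfolding subalgebra_def augmented_filtration_def
    by (simp add: space_measure_of sets_measure_of sets.sigma_sets_subset del: Un_subset_iff)
qed

end

theory Submission
  imports Defs
begin

text \<open>
  Write \<open>\<gamma>\<close> for the standard Gaussian measure and, for \<open>0 < r \<le> 1\<close>, put
  \<open>G\<^sub>r(x) = \<integral> f (sqrt r x + sqrt (1 - r) z) d\<gamma>(z)\<close>. By the Markov property the conditional
  expectation of \<open>f (B 1)\<close> given the augmented filtration at time \<open>r\<close> has the law of
  \<open>G\<^sub>r\<close> under \<open>\<gamma>\<close>, so the claim is the exponential form of Gaussian
  hypercontractivity \<open>\<integral> exp (G\<^sub>r / r) d\<gamma> \<le> (\<integral> exp f d\<gamma>) powr (1 / r)\<close>.

  For bounded \<open>f\<close> and rational \<open>r = k / n\<close> this follows from convexity and independence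
  (\<open>exp_hypercontractivity_rational\<close>). Let \<open>u\<^sub>1, \<dots>, u\<^sub>n\<close> be independent standard Gaussian vectors,
  let \<open>X\<close> be their sum divided by \<open>sqrt n\<close> and, for a set \<open>S\<close> of \<open>k\<close> indices, let \<open>W\<^sub>S\<close> be the sum
  over \<open>S\<close> divided by \<open>sqrt k\<close>. The pair \<open>(X, W\<^sub>S)\<close> has the law of
  \<open>(a, sqrt r a + sqrt (1 - r) b)\<close> with independent standard Gaussian \<open>a\<close> and \<open>b\<close>
  (\<open>distr_PiM_std_gaussian_total_partial\<close>), hence \<open>G\<^sub>r(X)\<close> is the conditional expectation of
  \<open>f (W\<^sub>S)\<close> given \<open>X\<close>. Let \<open>c = (n - 1) choose (k - 1)\<close> be the number of sets \<open>S\<close> that contain a given index.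
  There are \<open>c / r\<close> sets \<open>S\<close> in total, so \<open>G\<^sub>r(X) / r\<close> is the conditional expectation of the
  sum of all \<open>f (W\<^sub>S) / c\<close>. By Jensen's inequality, \<open>\<integral> exp (G\<^sub>r / r) d\<gamma>\<close> is at most the expectation of
  the product of all \<open>exp (f (W\<^sub>S)) powr (1 / c)\<close>, and Finner's inequality
  (\<open>finner_inequality_std_gaussian\<close>) bounds that by the product of the \<open>c / r\<close> equal factors
  \<open>(\<integral> exp f d\<gamma>) powr (1 / c)\<close>.

  A real time \<open>t < 1\<close> is approached by rationals \<open>r \<ge> t\<close>: Jensen's inequality and the tower property
  give the bound at time \<open>t\<close> with factor \<open>1 / r\<close> (\<open>exp_cond_exp_bounded_rational\<close>). Fatou's lemma,
  applied along \<open>r \<longlonglongrightarrow> t\<close> and along truncations of \<open>f\<close>, then gives the general case. For \<open>t = 1\<close>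
  there is equality.
\<close>

section \<open>The standard Gaussian measure and its reflection invariance\<close>

lemma prob_space_std_gaussian: "prob_space (std_gaussian :: (real ^ 'd::finite) measure)"
proof
  let ?\<gamma> = "std_gaussian :: (real ^ 'd) measure"
  have eq: "ennreal ((2 * pi) powr (- real CARD('d) / 2) * exp (- (norm x)\<^sup>2 / 2))
      = (\<Prod>b\<in>Basis. ennreal (std_normal_density (x \<bullet> b)))" for x :: "real ^ 'd"
  proof -
    have "(\<Prod>b\<in>(Basis::(real^'d) set). std_normal_density (x \<bullet> b))
        = (1 / sqrt (2 * pi)) ^ CARD('d) * exp (\<Sum>b\<in>(Basis::(real^'d) set). - (x \<bullet> b)\<^sup>2 / 2)"
      by (simp add: std_normal_density_def prod.distrib exp_sum power_one_over prod_dividef)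
    also have "(\<Sum>b\<in>(Basis::(real^'d) set). - (x \<bullet> b)\<^sup>2 / 2) = - (norm x)\<^sup>2 / 2"
      unfolding power2_norm_eq_inner euclidean_inner[of x x]
      by (simp add: sum_divide_distrib sum_negf power2_eq_square)
    also have "(1 / sqrt (2 * pi)) ^ CARD('d) = (2 * pi) powr (- real CARD('d) / 2)"
    proof -
      have "(1 / sqrt (2 * pi)) = (2 * pi) powr (- 1 / 2)"
        by (simp add: powr_minus_divide powr_half_sqrt)
      then have "(1 / sqrt (2 * pi)) ^ CARD('d) = ((2 * pi) powr (- 1 / 2)) powr (real CARD('d))"
        by (simp add: powr_realpow)
      then show ?thesis
        by (simp add: powr_powr mult.commute)
    qed
    finally show ?thesis
      by (simp add: prod_ennreal)
  qed
  have "emeasure ?\<gamma> (space ?\<gamma>) = (\<integral>\<^sup>+x. (\<Prod>b\<in>Basis. ennreal (std_normal_density ((x::real^'d) \<bullet> b))) \<partial>lborel)"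
    unfolding std_gaussian_def eq by (subst emeasure_density) simp_all
  also have "\<dots> = (\<Prod>b\<in>(Basis::(real^'d) set). (\<integral>\<^sup>+x. ennreal (std_normal_density x) \<partial>lborel))"
    using nn_integral_lborel_prod[of "\<lambda>(_ :: real ^ 'd) x. ennreal (std_normal_density x)"] by simp
  also have "(\<integral>\<^sup>+x. ennreal (std_normal_density x) \<partial>lborel) = 1"
    using prob_space.emeasure_space_1[OF prob_space_normal_density[of 1 0]]
    by (simp add: emeasure_density)
  finally show "emeasure ?\<gamma> (space ?\<gamma>) = 1" by simp
qed

lemma sets_std_gaussian [simp, measurable_cong]: "sets std_gaussian = sets borel"
  and space_std_gaussian [simp]: "space std_gaussian = UNIV"
  by (simp_all add: std_gaussian_def)

lemma nn_integral_lborel_affine: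
  fixes h :: "'a::euclidean_space \<Rightarrow> ennreal"
  assumes [measurable]: "h \<in> borel_measurable borel" and "c \<noteq> 0"
  shows "(\<integral>\<^sup>+x. h x \<partial>lborel) = ennreal (\<bar>c\<bar> ^ DIM('a)) * (\<integral>\<^sup>+x. h (t + c *\<^sub>R x) \<partial>lborel)"
  by (subst lborel_affine[OF \<open>c \<noteq> 0\<close>, of t])
     (simp add: nn_integral_density nn_integral_distr nn_integral_cmult)

text \<open>Lebesgue measure on pairs is invariant under the block reflection with entries \<open>c, s, s, -c\<close>
  when \<open>c\<^sup>2 + s\<^sup>2 = 1\<close>. Since \<open>s a - c b = (s / c) (c a + s b) - b / c\<close>, the map is a composition of an affine
  substitution in \<open>a\<close> and one in \<open>b\<close>, whose Jacobians \<open>c\<close> and \<open>1 / c\<close> (to the power of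
  the dimension) cancel.\<close>

lemma nn_integral_lborel_reflection:
  fixes K :: "'a::euclidean_space \<times> 'a \<Rightarrow> ennreal"
  assumes [measurable]: "K \<in> borel_measurable (borel \<Otimes>\<^sub>M borel)"
    and c: "c > 0" and cs: "c\<^sup>2 + s\<^sup>2 = 1"
  shows "(\<integral>\<^sup>+a. \<integral>\<^sup>+b. K (c *\<^sub>R a + s *\<^sub>R b, s *\<^sub>R a - c *\<^sub>R b) \<partial>lborel \<partial>lborel)
       = (\<integral>\<^sup>+a. \<integral>\<^sup>+b. K (a, b) \<partial>lborel \<partial>lborel)"
proof -
  let ?D = "DIM('a)"
  have second: "s *\<^sub>R a - c *\<^sub>R b = (s / c) *\<^sub>R (s *\<^sub>R b + c *\<^sub>R a) + (- 1 / c) *\<^sub>R b" for a b :: 'a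
  proof -
    have "s / c * s - 1 / c = - c"
      using c cs by (simp add: field_simps power2_eq_square)
    then have "(s / c * s) *\<^sub>R b + (- 1 / c) *\<^sub>R b = (- c) *\<^sub>R b"
      unfolding scaleR_add_left[symmetric] by (simp add: diff_conv_add_uminus del: add_uminus_conv_diff)
    with c show ?thesis
      by (simp add: scaleR_add_right algebra_simps)
  qed
  have "(\<integral>\<^sup>+a. \<integral>\<^sup>+b. K (c *\<^sub>R a + s *\<^sub>R b, s *\<^sub>R a - c *\<^sub>R b) \<partial>lborel \<partial>lborel)
      = (\<integral>\<^sup>+a. \<integral>\<^sup>+b. K (s *\<^sub>R b + c *\<^sub>R a, (s / c) *\<^sub>R (s *\<^sub>R b + c *\<^sub>R a) + (- 1 / c) *\<^sub>R b) \<partial>lborel \<partial>lborel)"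
    by (simp only: second) (simp only: add.commute)
  also have "\<dots> = (\<integral>\<^sup>+b. \<integral>\<^sup>+a. K (s *\<^sub>R b + c *\<^sub>R a, (s / c) *\<^sub>R (s *\<^sub>R b + c *\<^sub>R a) + (- 1 / c) *\<^sub>R b) \<partial>lborel \<partial>lborel)"
    by (rule lborel_pair.Fubini') simp
  also have "\<dots> = (\<integral>\<^sup>+b. ennreal ((1 / c) ^ ?D) * (\<integral>\<^sup>+a. K (a, (s / c) *\<^sub>R a + (- 1 / c) *\<^sub>R b) \<partial>lborel) \<partial>lborel)"
  proof (rule nn_integral_cong)
    fix b :: 'a
    have "(\<integral>\<^sup>+a. K (a, (s / c) *\<^sub>R a + (- 1 / c) *\<^sub>R b) \<partial>lborel) = ennreal (c ^ ?D) *
        (\<integral>\<^sup>+a. K (s *\<^sub>R b + c *\<^sub>R a, (s / c) *\<^sub>R (s *\<^sub>R b + c *\<^sub>R a) + (- 1 / c) *\<^sub>R b) \<partial>lborel)"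
      using c by (subst nn_integral_lborel_affine[of _ c "s *\<^sub>R b"]) auto
    moreover have "ennreal ((1 / c) ^ ?D) * ennreal (c ^ ?D) = 1"
      using c by (simp add: ennreal_mult[symmetric] power_mult_distrib[symmetric])
    ultimately show "(\<integral>\<^sup>+a. K (s *\<^sub>R b + c *\<^sub>R a, (s / c) *\<^sub>R (s *\<^sub>R b + c *\<^sub>R a) + (- 1 / c) *\<^sub>R b) \<partial>lborel)
       = ennreal ((1 / c) ^ ?D) * (\<integral>\<^sup>+a. K (a, (s / c) *\<^sub>R a + (- 1 / c) *\<^sub>R b) \<partial>lborel)"
      by (simp add: mult.assoc[symmetric])
  qed
  also have "\<dots> = ennreal ((1 / c) ^ ?D) * (\<integral>\<^sup>+a. \<integral>\<^sup>+b. K (a, (s / c) *\<^sub>R a + (- 1 / c) *\<^sub>R b) \<partial>lborel \<partial>lborel)"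
    by (subst lborel_pair.Fubini') (simp_all add: nn_integral_cmult)
  also have "\<dots> = (\<integral>\<^sup>+a. ennreal ((1 / c) ^ ?D) * (\<integral>\<^sup>+b. K (a, (s / c) *\<^sub>R a + (- 1 / c) *\<^sub>R b) \<partial>lborel) \<partial>lborel)"
    by (simp add: nn_integral_cmult)
  also have "\<dots> = (\<integral>\<^sup>+a. \<integral>\<^sup>+b. K (a, b) \<partial>lborel \<partial>lborel)"
  proof (rule nn_integral_cong)
    fix a :: 'a
    show "ennreal ((1 / c) ^ ?D) * (\<integral>\<^sup>+b. K (a, (s / c) *\<^sub>R a + (- 1 / c) *\<^sub>R b) \<partial>lborel) = (\<integral>\<^sup>+b. K (a, b) \<partial>lborel)"
      using c nn_integral_lborel_affine[of "\<lambda>b. K (a, b)" "- 1 / c" "(s / c) *\<^sub>R a"] by simp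
  qed
  finally show ?thesis .
qed

lemma std_gaussian_reflection:
  fixes H :: "(real ^ 'd::finite) \<times> (real ^ 'd) \<Rightarrow> ennreal"
  assumes [measurable]: "H \<in> borel_measurable (borel \<Otimes>\<^sub>M borel)"
    and c: "c > 0" and cs: "c\<^sup>2 + s\<^sup>2 = 1"
  shows "(\<integral>\<^sup>+a. \<integral>\<^sup>+b. H (c *\<^sub>R a + s *\<^sub>R b, s *\<^sub>R a - c *\<^sub>R b) \<partial>std_gaussian \<partial>std_gaussian)
       = (\<integral>\<^sup>+a. \<integral>\<^sup>+b. H (a, b) \<partial>std_gaussian \<partial>std_gaussian)"
proof -
  define \<rho> :: "real ^ 'd \<Rightarrow> real"
    where "\<rho> x = (2 * pi) powr (- real CARD('d) / 2) * exp (- (norm x)\<^sup>2 / 2)" for x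
  have [measurable]: "\<rho> \<in> borel_measurable borel"
    unfolding \<rho>_def by measurable
  have \<rho>0: "\<rho> x \<ge> 0" for x by (simp add: \<rho>_def)
  have g: "(std_gaussian :: (real ^ 'd) measure) = density lborel (\<lambda>x. ennreal (\<rho> x))"
    by (simp add: std_gaussian_def \<rho>_def)
  have dens: "(\<integral>\<^sup>+a. \<integral>\<^sup>+b. K (a, b) \<partial>std_gaussian \<partial>std_gaussian)
      = (\<integral>\<^sup>+a. \<integral>\<^sup>+b. ennreal (\<rho> a * \<rho> b) * K (a, b) \<partial>lborel \<partial>lborel)"
    if [measurable]: "K \<in> borel_measurable (borel \<Otimes>\<^sub>M borel)" for K :: "(real ^ 'd) \<times> (real ^ 'd) \<Rightarrow> ennreal"
    unfolding g
    by (simp add: nn_integral_density nn_integral_cmult[symmetric] ennreal_mult \<rho>0 mult.assoc)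
  have inv: "\<rho> a * \<rho> b = \<rho> (c *\<^sub>R a + s *\<^sub>R b) * \<rho> (s *\<^sub>R a - c *\<^sub>R b)" for a b
  proof -
    have "(norm (c *\<^sub>R a + s *\<^sub>R b))\<^sup>2 + (norm (s *\<^sub>R a - c *\<^sub>R b))\<^sup>2
        = (c\<^sup>2 + s\<^sup>2) * ((norm a)\<^sup>2 + (norm b)\<^sup>2)"
      unfolding power2_norm_eq_inner inner_add_left inner_add_right inner_diff_left
        inner_diff_right inner_scaleR_left inner_scaleR_right inner_commute[of b a]
      by algebra
    then have "exp (- (norm a)\<^sup>2 / 2) * exp (- (norm b)\<^sup>2 / 2)
      = exp (- (norm (c *\<^sub>R a + s *\<^sub>R b))\<^sup>2 / 2) * exp (- (norm (s *\<^sub>R a - c *\<^sub>R b))\<^sup>2 / 2)"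
      by (simp add: cs exp_add[symmetric] add_divide_distrib[symmetric] algebra_simps)
    then show ?thesis
      by (simp add: \<rho>_def mult_ac)
  qed
  have "(\<integral>\<^sup>+a. \<integral>\<^sup>+b. H (c *\<^sub>R a + s *\<^sub>R b, s *\<^sub>R a - c *\<^sub>R b) \<partial>std_gaussian \<partial>std_gaussian)
      = (\<integral>\<^sup>+a. \<integral>\<^sup>+b. (\<lambda>(a, b). ennreal (\<rho> a * \<rho> b) * H (a, b)) (c *\<^sub>R a + s *\<^sub>R b, s *\<^sub>R a - c *\<^sub>R b) \<partial>lborel \<partial>lborel)"
    using dens[of "\<lambda>(a, b). H (c *\<^sub>R a + s *\<^sub>R b, s *\<^sub>R a - c *\<^sub>R b)"]
    by (simp add: inv[symmetric])
  also have "\<dots> = (\<integral>\<^sup>+a. \<integral>\<^sup>+b. (\<lambda>(a, b). ennreal (\<rho> a * \<rho> b) * H (a, b)) (a, b) \<partial>lborel \<partial>lborel)"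
    by (rule nn_integral_lborel_reflection[OF _ c cs]) measurable
  also have "\<dots> = (\<integral>\<^sup>+a. \<integral>\<^sup>+b. H (a, b) \<partial>std_gaussian \<partial>std_gaussian)"
    by (simp add: dens)
  finally show ?thesis .
qed

section \<open>Sums of independent Gaussian vectors\<close>

lemma pair_prob_space_std_gaussian:
  "pair_prob_space (std_gaussian :: (real ^ 'd::finite) measure) (std_gaussian :: (real ^ 'd) measure)"
  by (simp add: pair_prob_space_def pair_sigma_finite_def prob_space_imp_sigma_finite
      prob_space_std_gaussian)

lemma product_prob_space_std_gaussian:
  "product_prob_space (\<lambda>_::'i. std_gaussian :: (real ^ 'd::finite) measure)"
  by (simp add: product_prob_space_def product_prob_space_axioms_def product_sigma_finite_def
      prob_space_imp_sigma_finite prob_space_std_gaussian)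

lemma std_gaussian_Fubini:
  fixes K :: "(real ^ 'd::finite) \<Rightarrow> (real ^ 'd) \<Rightarrow> ennreal"
  assumes "case_prod K \<in> borel_measurable (borel \<Otimes>\<^sub>M borel)"
  shows "(\<integral>\<^sup>+a. \<integral>\<^sup>+b. K a b \<partial>std_gaussian \<partial>std_gaussian)
    = (\<integral>\<^sup>+b. \<integral>\<^sup>+a. K a b \<partial>std_gaussian \<partial>std_gaussian)"
proof -
  interpret pair_prob_space "std_gaussian :: (real ^ 'd) measure" "std_gaussian :: (real ^ 'd) measure"
    by (rule pair_prob_space_std_gaussian)
  show ?thesis
  proof (rule Fubini'[symmetric])
    show "case_prod K \<in> borel_measurable (std_gaussian \<Otimes>\<^sub>M std_gaussian)"
      using assms by simp
  qed
qed

text \<open>Reflect the pair \<open>(a, b)\<close> so that its first component becomes the normalised combination of \<open>a\<close> and \<open>b\<close>,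
  and integrate the second component out.\<close>

lemma std_gaussian_convolution:
  fixes h :: "real ^ 'd::finite \<Rightarrow> ennreal"
  assumes h [measurable]: "h \<in> borel_measurable borel" and p: "p \<ge> 0" and q: "q \<ge> 0"
  shows "(\<integral>\<^sup>+a. \<integral>\<^sup>+b. h (sqrt p *\<^sub>R a + sqrt q *\<^sub>R b) \<partial>std_gaussian \<partial>std_gaussian)
       = (\<integral>\<^sup>+a. h (sqrt (p + q) *\<^sub>R a) \<partial>std_gaussian)"
proof -
  interpret prob_space "std_gaussian :: (real ^ 'd) measure"
    by (rule prob_space_std_gaussian)
  have total: "emeasure std_gaussian (UNIV :: (real ^ 'd) set) = 1"
    using emeasure_space_1 by simp
  show ?thesis
  proof (cases "p = 0")
    case True
    then show ?thesis by (simp add: total)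
  next
    case False
    with p q have pos: "p > 0" "p + q > 0" by auto
    define c s where "c = sqrt (p / (p + q))" and "s = sqrt (q / (p + q))"
    have c: "c > 0" "c\<^sup>2 + s\<^sup>2 = 1"
      using pos q by (simp_all add: c_def s_def add_divide_distrib[symmetric])
    have cs: "sqrt (p + q) * c = sqrt p" "sqrt (p + q) * s = sqrt q"
      using pos by (simp_all add: c_def s_def real_sqrt_mult[symmetric])
    have "(\<integral>\<^sup>+a. \<integral>\<^sup>+b. h (sqrt p *\<^sub>R a + sqrt q *\<^sub>R b) \<partial>std_gaussian \<partial>std_gaussian)
      = (\<integral>\<^sup>+a. \<integral>\<^sup>+b. (\<lambda>(a, b). h (sqrt (p + q) *\<^sub>R a)) (c *\<^sub>R a + s *\<^sub>R b, s *\<^sub>R a - c *\<^sub>R b) \<partial>std_gaussian \<partial>std_gaussian)"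
      by (simp add: scaleR_add_right cs)
    also have "\<dots> = (\<integral>\<^sup>+a. \<integral>\<^sup>+b. (\<lambda>(a, b). h (sqrt (p + q) *\<^sub>R a)) (a, b :: real ^ 'd) \<partial>std_gaussian \<partial>std_gaussian)"
      by (rule std_gaussian_reflection[OF _ c]) measurable
    also have "\<dots> = (\<integral>\<^sup>+a. h (sqrt (p + q) *\<^sub>R a) \<partial>std_gaussian)"
      by (simp add: total)
    finally show ?thesis .
  qed
qed

text \<open>The sums of independent standard Gaussian vectors over two complementary sets of indices are independent
  Gaussian vectors, with variances the cardinalities of these sets.\<close>

lemma nn_integral_PiM_std_gaussian_sums:
  fixes H :: "(real ^ 'd::finite) \<Rightarrow> (real ^ 'd) \<Rightarrow> ennreal"
  assumes "finite I" and "case_prod H \<in> borel_measurable (borel \<Otimes>\<^sub>M borel)"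
  shows "(\<integral>\<^sup>+u. H (\<Sum>i\<in>I \<inter> S. u i) (\<Sum>i\<in>I - S. u i) \<partial>PiM I (\<lambda>_. std_gaussian))
    = (\<integral>\<^sup>+a. \<integral>\<^sup>+b. H (sqrt (card (I \<inter> S)) *\<^sub>R a) (sqrt (card (I - S)) *\<^sub>R b) \<partial>std_gaussian \<partial>std_gaussian)"
  using assms
proof (induction I arbitrary: H)
  case empty
  interpret prob_space "std_gaussian :: (real ^ 'd) measure"
    by (rule prob_space_std_gaussian)
  show ?case
    using emeasure_space_1 by (simp add: PiM_empty nn_integral_count_space_finite)
next
  case (insert i I)
  interpret product_prob_space "\<lambda>_. std_gaussian :: (real ^ 'd) measure"
    by (rule product_prob_space_std_gaussian)
  note [measurable] = insert.prems
  have m: "(\<lambda>u. H (\<Sum>i\<in>insert i I \<inter> S. u i) (\<Sum>i\<in>insert i I - S. u i))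
      \<in> borel_measurable (PiM (insert i I) (\<lambda>_. std_gaussian))"
    by measurable
  show ?case
  proof (cases "i \<in> S")
    case True
    have "(\<Sum>j\<in>insert i I \<inter> S. (u(i := y)) j) = (\<Sum>j\<in>I \<inter> S. u j) + y"
        "(\<Sum>j\<in>insert i I - S. (u(i := y)) j) = (\<Sum>j\<in>I - S. u j)" for u and y :: "real ^ 'd"
      using insert.hyps True by (auto simp: add.commute intro!: sum.cong)
    then have "(\<integral>\<^sup>+u. H (\<Sum>i\<in>insert i I \<inter> S. u i) (\<Sum>i\<in>insert i I - S. u i) \<partial>PiM (insert i I) (\<lambda>_. std_gaussian))
        = (\<integral>\<^sup>+u. (\<integral>\<^sup>+y. H ((\<Sum>i\<in>I \<inter> S. u i) + y) (\<Sum>i\<in>I - S. u i) \<partial>std_gaussian) \<partial>PiM I (\<lambda>_. std_gaussian))"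
      by (simp only: product_nn_integral_insert[OF insert.hyps m])
    also have "\<dots> = (\<integral>\<^sup>+a. \<integral>\<^sup>+b. \<integral>\<^sup>+y. H (sqrt (card (I \<inter> S)) *\<^sub>R a + y) (sqrt (card (I - S)) *\<^sub>R b) \<partial>std_gaussian \<partial>std_gaussian \<partial>std_gaussian)"
      by (rule insert.IH[of "\<lambda>v w. \<integral>\<^sup>+y. H (v + y) w \<partial>std_gaussian"]) measurable
    also have "\<dots> = (\<integral>\<^sup>+b. \<integral>\<^sup>+a. \<integral>\<^sup>+y. H (sqrt (card (I \<inter> S)) *\<^sub>R a + sqrt 1 *\<^sub>R y) (sqrt (card (I - S)) *\<^sub>R b) \<partial>std_gaussian \<partial>std_gaussian \<partial>std_gaussian)"
      by (subst std_gaussian_Fubini) simp_all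
    also have "\<dots> = (\<integral>\<^sup>+b. \<integral>\<^sup>+a. H (sqrt (real (card (I \<inter> S)) + 1) *\<^sub>R a) (sqrt (card (I - S)) *\<^sub>R b) \<partial>std_gaussian \<partial>std_gaussian)"
    proof (rule nn_integral_cong)
      fix b :: "real ^ 'd"
      show "(\<integral>\<^sup>+a. \<integral>\<^sup>+y. H (sqrt (card (I \<inter> S)) *\<^sub>R a + sqrt 1 *\<^sub>R y) (sqrt (card (I - S)) *\<^sub>R b) \<partial>std_gaussian \<partial>std_gaussian)
        = (\<integral>\<^sup>+a. H (sqrt (real (card (I \<inter> S)) + 1) *\<^sub>R a) (sqrt (card (I - S)) *\<^sub>R b) \<partial>std_gaussian)"
        by (rule std_gaussian_convolution[of "\<lambda>a. H a (sqrt (card (I - S)) *\<^sub>R b)"]) simp_all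
    qed
    also have "\<dots> = (\<integral>\<^sup>+a. \<integral>\<^sup>+b. H (sqrt (real (card (I \<inter> S)) + 1) *\<^sub>R a) (sqrt (card (I - S)) *\<^sub>R b) \<partial>std_gaussian \<partial>std_gaussian)"
      by (subst std_gaussian_Fubini) simp_all
    finally show ?thesis
      using insert.hyps True by (simp add: add.commute)
  next
    case False
    have "(\<Sum>j\<in>insert i I \<inter> S. (u(i := y)) j) = (\<Sum>j\<in>I \<inter> S. u j)"
        "(\<Sum>j\<in>insert i I - S. (u(i := y)) j) = (\<Sum>j\<in>I - S. u j) + y" for u and y :: "real ^ 'd"
      using insert.hyps False by (auto simp: add.commute insert_Diff_if intro!: sum.cong)
    then have "(\<integral>\<^sup>+u. H (\<Sum>i\<in>insert i I \<inter> S. u i) (\<Sum>i\<in>insert i I - S. u i) \<partial>PiM (insert i I) (\<lambda>_. std_gaussian))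
        = (\<integral>\<^sup>+u. (\<integral>\<^sup>+y. H (\<Sum>i\<in>I \<inter> S. u i) ((\<Sum>i\<in>I - S. u i) + y) \<partial>std_gaussian) \<partial>PiM I (\<lambda>_. std_gaussian))"
      by (simp only: product_nn_integral_insert[OF insert.hyps m])
    also have "\<dots> = (\<integral>\<^sup>+a. \<integral>\<^sup>+b. \<integral>\<^sup>+y. H (sqrt (card (I \<inter> S)) *\<^sub>R a) (sqrt (card (I - S)) *\<^sub>R b + sqrt 1 *\<^sub>R y) \<partial>std_gaussian \<partial>std_gaussian \<partial>std_gaussian)"
      by (subst insert.IH[of "\<lambda>v w. \<integral>\<^sup>+y. H v (w + y) \<partial>std_gaussian"]) simp_all
    also have "\<dots> = (\<integral>\<^sup>+a. \<integral>\<^sup>+b. H (sqrt (card (I \<inter> S)) *\<^sub>R a) (sqrt (real (card (I - S)) + 1) *\<^sub>R b) \<partial>std_gaussian \<partial>std_gaussian)"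
    proof (rule nn_integral_cong)
      fix a :: "real ^ 'd"
      show "(\<integral>\<^sup>+b. \<integral>\<^sup>+y. H (sqrt (card (I \<inter> S)) *\<^sub>R a) (sqrt (card (I - S)) *\<^sub>R b + sqrt 1 *\<^sub>R y) \<partial>std_gaussian \<partial>std_gaussian)
        = (\<integral>\<^sup>+b. H (sqrt (card (I \<inter> S)) *\<^sub>R a) (sqrt (real (card (I - S)) + 1) *\<^sub>R b) \<partial>std_gaussian)"
        by (rule std_gaussian_convolution[of "H (sqrt (card (I \<inter> S)) *\<^sub>R a)"]) simp_all
    qed
    finally show ?thesis
      using insert.hyps False by (simp add: add.commute insert_Diff_if)
  qed
qed

lemma integrable_std_gaussian_bounded:
  fixes h :: "real ^ 'd::finite \<Rightarrow> real"
  assumes [measurable]: "h \<in> borel_measurable borel" and "\<And>x. \<bar>h x\<bar> \<le> C"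
  shows "integrable std_gaussian h"
proof -
  interpret prob_space "std_gaussian :: (real ^ 'd) measure"
    by (rule prob_space_std_gaussian)
  show ?thesis
    by (rule integrable_const_bound[of _ C]) (use assms(2) in auto)
qed

lemma integral_std_gaussian_exp_bounds:
  fixes h :: "real ^ 'd::finite \<Rightarrow> real"
  assumes [measurable]: "h \<in> borel_measurable borel" and b: "\<And>x. \<bar>h x\<bar> \<le> C"
  shows "integrable std_gaussian (\<lambda>x. exp (h x))"
    and "exp (- C) \<le> (\<integral>x. exp (h x) \<partial>std_gaussian)"
    and "(\<integral>x. exp (h x) \<partial>std_gaussian) \<le> exp C"
proof -
  interpret prob_space "std_gaussian :: (real ^ 'd) measure"
    by (rule prob_space_std_gaussian)
  have le: "- C \<le> h x" "h x \<le> C" for x using b[of x] by auto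
  show int: "integrable std_gaussian (\<lambda>x. exp (h x))"
    by (rule integrable_std_gaussian_bounded[of _ "exp C"]) (use le in auto)
  show "exp (- C) \<le> (\<integral>x. exp (h x) \<partial>std_gaussian)"
    by (rule integral_ge_const[OF int]) (use le in auto)
  show "(\<integral>x. exp (h x) \<partial>std_gaussian) \<le> exp C"
    by (rule integral_le_const[OF int]) (use le in auto)
qed

lemma exp_integral_convolution:
  fixes h :: "real ^ 'd::finite \<Rightarrow> real"
  assumes [measurable]: "h \<in> borel_measurable borel" and b: "\<And>x. \<bar>h x\<bar> \<le> C"
    and p: "p \<ge> 0" and q: "q \<ge> 0"
  shows "(\<integral>a. (\<integral>b. exp (h (sqrt p *\<^sub>R a + sqrt q *\<^sub>R b)) \<partial>std_gaussian) \<partial>std_gaussian)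
       = (\<integral>a. exp (h (sqrt (p + q) *\<^sub>R a)) \<partial>std_gaussian)"
proof -
  have "ennreal (\<integral>b. exp (h (w + sqrt q *\<^sub>R b)) \<partial>std_gaussian)
      = (\<integral>\<^sup>+b. exp (h (w + sqrt q *\<^sub>R b)) \<partial>std_gaussian)" for w
    by (intro nn_integral_eq_integral[symmetric] integral_std_gaussian_exp_bounds(1)[where C = C] b) auto
  note inner = this
  interpret prob_space "std_gaussian :: (real ^ 'd) measure"
    by (rule prob_space_std_gaussian)
  have "(\<integral>a. (\<integral>b. exp (h (sqrt p *\<^sub>R a + sqrt q *\<^sub>R b)) \<partial>std_gaussian) \<partial>std_gaussian)
      = enn2real (\<integral>\<^sup>+a. ennreal (\<integral>b. exp (h (sqrt p *\<^sub>R a + sqrt q *\<^sub>R b)) \<partial>std_gaussian) \<partial>std_gaussian)"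
    by (rule integral_eq_nn_integral) auto
  also have "\<dots> = enn2real (\<integral>\<^sup>+a. exp (h (sqrt (p + q) *\<^sub>R a)) \<partial>std_gaussian)"
    by (simp only: inner) (simp add: std_gaussian_convolution[of "\<lambda>x. ennreal (exp (h x))"] p q)
  also have "\<dots> = (\<integral>a. exp (h (sqrt (p + q) *\<^sub>R a)) \<partial>std_gaussian)"
    by (rule integral_eq_nn_integral[symmetric]) auto
  finally show ?thesis .
qed

section \<open>A Finner-type inequality for functions of partial sums\<close>

lemma exp_mean_le_mean_exp:
  fixes x :: "'j \<Rightarrow> real"
  assumes "finite J" "card J = c" "c > 0"
  shows "exp ((\<Sum>j\<in>J. x j) / c) \<le> (\<Sum>j\<in>J. exp (x j)) / c"
proof -
  have "exp (\<Sum>j\<in>J. (1 / c) *\<^sub>R x j) \<le> (\<Sum>j\<in>J. (1 / c) * exp (x j))"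
    using assms by (intro convex_on_sum[where C = UNIV] exp_convex) auto
  then show ?thesis
    by (simp add: sum_divide_distrib)
qed

text \<open>Finner's inequality for functions of partial sums of independent Gaussian vectors: if each index \<open>i\<close> lies in
  exactly \<open>c\<close> of the sets \<open>S j\<close>, then the expectation of the product of the \<open>c\<close>-th roots of the
  \<open>exp (f j)\<close> is at most the product of the \<open>c\<close>-th roots of their expectations. By the convolution
  property, the expectation of the \<open>j\<close>-th factor is an integral over a single Gaussian vector.

  The proof integrates out one index \<open>i\<close> at a time. This replaces \<open>f j\<close>, for the \<open>c\<close> values of \<open>j\<close> with
  \<open>i \<in> S j\<close>, by the logarithm of the Gaussian average of \<open>exp (f j)\<close>; after normalisation by
  these averages, the needed form of Hoelder's inequality is the inequality between geometric and arithmetic means.\<close>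

lemma finner_inequality_std_gaussian:
  fixes f :: "'j \<Rightarrow> real ^ 'd::finite \<Rightarrow> real" and S :: "'j \<Rightarrow> 'i set"
  assumes "finite I" and "finite J" and "c > 0"
    and "\<And>i. i \<in> I \<Longrightarrow> card {j \<in> J. i \<in> S j} = c"
    and "\<And>j. f j \<in> borel_measurable borel" and "\<And>j x. \<bar>f j x\<bar> \<le> C"
  shows "(\<integral>\<^sup>+u. ennreal (exp ((\<Sum>j\<in>J. f j (\<Sum>i\<in>I \<inter> S j. u i)) / c)) \<partial>PiM I (\<lambda>_. std_gaussian))
    \<le> ennreal (exp ((\<Sum>j\<in>J. ln (\<integral>a. exp (f j (sqrt (card (I \<inter> S j)) *\<^sub>R a)) \<partial>std_gaussian)) / c))"
  using assms(1,4-)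
proof (induction I arbitrary: f)
  case empty
  interpret prob_space "std_gaussian :: (real ^ 'd) measure"
    by (rule prob_space_std_gaussian)
  show ?case
    using prob_space by (simp add: PiM_empty nn_integral_count_space_finite)
next
  case (insert i I)
  interpret \<gamma>: prob_space "std_gaussian :: (real ^ 'd) measure"
    by (rule prob_space_std_gaussian)
  interpret product_prob_space "\<lambda>_. std_gaussian :: (real ^ 'd) measure"
    by (rule product_prob_space_std_gaussian)
  note [measurable] = insert.prems(2)
  note bound = insert.prems(3)
  define L where "L = (\<lambda>j w. ln (\<integral>z. exp (f j (w + z)) \<partial>std_gaussian))"
  define f' where "f' j w = (if i \<in> S j then L j w else f j w)" for j w
  have exp_L: "exp (L j w) = (\<integral>z. exp (f j (w + z)) \<partial>std_gaussian)"
    and L_bound: "\<bar>L j w\<bar> \<le> C" for j w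
  proof -
    have b: "exp (- C) \<le> (\<integral>z. exp (f j (w + z)) \<partial>std_gaussian)"
      "(\<integral>z. exp (f j (w + z)) \<partial>std_gaussian) \<le> exp C"
      by (rule integral_std_gaussian_exp_bounds; use bound in simp)+
    then have pos: "0 < (\<integral>z. exp (f j (w + z)) \<partial>std_gaussian)"
      using exp_gt_zero less_le_trans by blast
    then show eq: "exp (L j w) = (\<integral>z. exp (f j (w + z)) \<partial>std_gaussian)"
      by (simp add: L_def)
    have "exp (- C) \<le> exp (L j w)" "exp (L j w) \<le> exp C"
      using b eq by simp_all
    then show "\<bar>L j w\<bar> \<le> C"
      by (simp add: abs_le_iff)
  qed
  have L_meas [measurable]: "L j \<in> borel_measurable borel" for j
    unfolding L_def by measurable
  have f'_meas [measurable]: "f' j \<in> borel_measurable borel" for j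
    unfolding f'_def by simp
  have f'_bound: "\<bar>f' j w\<bar> \<le> C" for j w
    by (simp add: f'_def L_bound bound)
  have card_i: "card {j \<in> J. i \<in> S j} = c"
    by (rule insert.prems(1)) simp
  \<comment> \<open>The factors that do not involve the coordinate \<open>i\<close> are constant in the integration; the normalised others have mean 1.\<close>
  have step: "(\<integral>\<^sup>+z. ennreal (exp ((\<Sum>j\<in>J. f j (w j + (if i \<in> S j then z else 0))) / c)) \<partial>std_gaussian)
      \<le> ennreal (exp ((\<Sum>j\<in>J. f' j (w j)) / c))" for w :: "'j \<Rightarrow> real ^ 'd"
  proof -
    let ?J = "{j \<in> J. i \<in> S j}"
    have fin: "finite ?J" using \<open>finite J\<close> by simp
    have int: "integrable std_gaussian (\<lambda>z. exp (f j (w j + z) - L j (w j)))" for j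
      unfolding exp_diff
      by (intro integrable_divide integral_std_gaussian_exp_bounds(1)[where C = C] bound) simp
    have one: "(\<integral>z. exp (f j (w j + z) - L j (w j)) \<partial>std_gaussian) = 1" for j
      by (simp add: exp_diff exp_L[symmetric])
    have split: "(\<Sum>j\<in>J. f j (w j + (if i \<in> S j then z else 0)))
        = (\<Sum>j\<in>J. f' j (w j)) + (\<Sum>j\<in>?J. f j (w j + z) - L j (w j))" for z
    proof -
      have "(\<Sum>j\<in>?J. f j (w j + z) - L j (w j)) = (\<Sum>j\<in>J. if i \<in> S j then f j (w j + z) - L j (w j) else 0)"
        using \<open>finite J\<close> by (simp add: sum.inter_filter)
      then show ?thesis
        by (simp add: sum.distrib[symmetric]) (intro sum.cong, auto simp: f'_def)
    qed
    have "exp ((\<Sum>j\<in>J. f j (w j + (if i \<in> S j then z else 0))) / c)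
        \<le> exp ((\<Sum>j\<in>J. f' j (w j)) / c) * ((\<Sum>j\<in>?J. exp (f j (w j + z) - L j (w j))) / c)" for z
      unfolding split add_divide_distrib exp_add
      by (intro mult_left_mono exp_mean_le_mean_exp fin card_i \<open>c > 0\<close>) simp
    then have "(\<integral>\<^sup>+z. ennreal (exp ((\<Sum>j\<in>J. f j (w j + (if i \<in> S j then z else 0))) / c)) \<partial>std_gaussian)
      \<le> (\<integral>\<^sup>+z. ennreal (exp ((\<Sum>j\<in>J. f' j (w j)) / c) * ((\<Sum>j\<in>?J. exp (f j (w j + z) - L j (w j))) / c)) \<partial>std_gaussian)"
      by (intro nn_integral_mono ennreal_leI)
    also have "\<dots> = ennreal (\<integral>z. exp ((\<Sum>j\<in>J. f' j (w j)) / c) * ((\<Sum>j\<in>?J. exp (f j (w j + z) - L j (w j))) / c) \<partial>std_gaussian)"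
      by (intro nn_integral_eq_integral integrable_mult_right integrable_divide Bochner_Integration.integrable_sum int)
         (simp add: sum_nonneg)
    also have "(\<integral>z. exp ((\<Sum>j\<in>J. f' j (w j)) / c) * ((\<Sum>j\<in>?J. exp (f j (w j + z) - L j (w j))) / c) \<partial>std_gaussian)
        = exp ((\<Sum>j\<in>J. f' j (w j)) / c)"
      using \<open>c > 0\<close> by (simp add: Bochner_Integration.integral_sum int one card_i)
    finally show ?thesis .
  qed
  have m: "(\<lambda>u. ennreal (exp ((\<Sum>j\<in>J. f j (\<Sum>i\<in>insert i I \<inter> S j. u i)) / c)))
      \<in> borel_measurable (PiM (insert i I) (\<lambda>_. std_gaussian))"
    by measurable
  have sums: "(\<Sum>k\<in>insert i I \<inter> S j. (u(i := z)) k) = (\<Sum>k\<in>I \<inter> S j. u k) + (if i \<in> S j then z else 0)"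
    for u j and z :: "real ^ 'd"
    using insert.hyps by (auto simp: add.commute intro!: sum.cong)
  have card: "(\<integral>a. exp (f' j (sqrt (card (I \<inter> S j)) *\<^sub>R a)) \<partial>std_gaussian)
      = (\<integral>a. exp (f j (sqrt (card (insert i I \<inter> S j)) *\<^sub>R a)) \<partial>std_gaussian)" for j
  proof (cases "i \<in> S j")
    case True
    then have "(\<integral>a. exp (f' j (sqrt (card (I \<inter> S j)) *\<^sub>R a)) \<partial>std_gaussian)
        = (\<integral>a. (\<integral>z. exp (f j (sqrt (card (I \<inter> S j)) *\<^sub>R a + sqrt 1 *\<^sub>R z)) \<partial>std_gaussian) \<partial>std_gaussian)"
      by (simp add: f'_def exp_L)
    also have "\<dots> = (\<integral>a. exp (f j (sqrt (real (card (I \<inter> S j)) + 1) *\<^sub>R a)) \<partial>std_gaussian)"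
      by (rule exp_integral_convolution[where C = C]) (simp_all add: bound)
    finally show ?thesis
      using insert.hyps True by (simp add: add.commute)
  qed (simp add: f'_def)
  have "(\<integral>\<^sup>+u. ennreal (exp ((\<Sum>j\<in>J. f j (\<Sum>i\<in>insert i I \<inter> S j. u i)) / c)) \<partial>PiM (insert i I) (\<lambda>_. std_gaussian))
      = (\<integral>\<^sup>+u. (\<integral>\<^sup>+z. ennreal (exp ((\<Sum>j\<in>J. f j ((\<Sum>k\<in>I \<inter> S j. u k) + (if i \<in> S j then z else 0))) / c)) \<partial>std_gaussian) \<partial>PiM I (\<lambda>_. std_gaussian))"
    by (simp only: product_nn_integral_insert[OF insert.hyps m] sums)
  also have "\<dots> \<le> (\<integral>\<^sup>+u. ennreal (exp ((\<Sum>j\<in>J. f' j (\<Sum>k\<in>I \<inter> S j. u k)) / c)) \<partial>PiM I (\<lambda>_. std_gaussian))"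
    by (intro nn_integral_mono step)
  also have "\<dots> \<le> ennreal (exp ((\<Sum>j\<in>J. ln (\<integral>a. exp (f' j (sqrt (card (I \<inter> S j)) *\<^sub>R a)) \<partial>std_gaussian)) / c))"
    by (rule insert.IH) (simp_all add: insert.prems f'_bound)
  finally show ?case
    by (simp only: card)
qed

section \<open>The exponential inequality at rational times\<close>

text \<open>With \<open>a\<close> and \<open>b\<close> the normalised sums over \<open>S\<close> and over its complement, the total is \<open>sqrt r a + sqrt (1 - r) b\<close>.
  The reflection invariance turns this pair of independent vectors into the total and an independent
  standard Gaussian vector.\<close>

lemma distr_PiM_std_gaussian_total_partial:
  fixes n k :: nat
  assumes k: "0 < k" "k \<le> n" and S: "S \<subseteq> {..<n}" "card S = k"
  defines "r \<equiv> real k / real n"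
  shows "distr (PiM {..<n} (\<lambda>_. std_gaussian :: (real ^ 'd::finite) measure)) (borel \<Otimes>\<^sub>M borel)
      (\<lambda>u. ((1 / sqrt n) *\<^sub>R (\<Sum>i<n. u i), (1 / sqrt k) *\<^sub>R (\<Sum>i\<in>S. u i)))
    = distr (std_gaussian \<Otimes>\<^sub>M std_gaussian) (borel \<Otimes>\<^sub>M borel)
      (\<lambda>(a, b). (a, sqrt r *\<^sub>R a + sqrt (1 - r) *\<^sub>R b))" (is "?L = ?R")
proof (rule measure_eqI)
  show "sets ?L = sets ?R" by simp
  fix A assume "A \<in> sets ?L"
  then have [measurable]: "A \<in> sets (borel \<Otimes>\<^sub>M borel)" by simp
  interpret pair_prob_space "std_gaussian :: (real ^ 'd) measure" "std_gaussian :: (real ^ 'd) measure"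
    by (rule pair_prob_space_std_gaussian)
  have n: "n > 0" using k by simp
  have r: "0 < r" "r \<le> 1" using k by (simp_all add: r_def)
  have inter: "{..<n} \<inter> S = S" using S by auto
  have card_diff: "card ({..<n} - S) = n - k"
    using S by (simp add: card_Diff_subset finite_subset[of S])
  define c s where "c = sqrt r" and "s = sqrt (1 - r)"
  have cs: "c > 0" "c\<^sup>2 + s\<^sup>2 = 1" using r by (simp_all add: c_def s_def)
  have c_eq: "1 / sqrt n * sqrt k = c" using n by (simp add: c_def r_def real_sqrt_divide)
  have "1 - r = real (n - k) / n" using n k by (simp add: r_def field_simps of_nat_diff)
  then have s_eq: "1 / sqrt n * sqrt (real (n - k)) = s" by (simp add: s_def real_sqrt_divide)
  have refl_eq: "c *\<^sub>R (c *\<^sub>R a + s *\<^sub>R b) + s *\<^sub>R (s *\<^sub>R a - c *\<^sub>R b) = a" for a b :: "real ^ 'd"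
  proof -
    have "c *\<^sub>R (c *\<^sub>R a + s *\<^sub>R b) + s *\<^sub>R (s *\<^sub>R a - c *\<^sub>R b) = (c\<^sup>2 + s\<^sup>2) *\<^sub>R a"
      by (simp add: algebra_simps power2_eq_square)
    then show ?thesis by (simp add: cs)
  qed
  define H :: "real ^ 'd \<Rightarrow> real ^ 'd \<Rightarrow> ennreal"
    where "H v w = indicator A ((1 / sqrt n) *\<^sub>R (v + w), (1 / sqrt k) *\<^sub>R v)" for v w
  have H_meas: "case_prod H \<in> borel_measurable (borel \<Otimes>\<^sub>M borel)"
    unfolding H_def[abs_def] by measurable
  have [measurable]: "(\<lambda>u. \<Sum>i\<in>T. u i) \<in> borel_measurable (PiM {..<n} (\<lambda>_. std_gaussian :: (real ^ 'd) measure))"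
    if "T \<subseteq> {..<n}" for T
    using that by (intro borel_measurable_sum) (auto intro!: measurable_component_singleton[THEN measurable_compose] simp: subset_iff)
  note [measurable] = this[OF S(1)] this[OF subset_refl]
  have "emeasure ?L A = (\<integral>\<^sup>+z. indicator A z \<partial>?L)"
    by (rule nn_integral_indicator[symmetric]) simp
  also have "\<dots> = (\<integral>\<^sup>+u. indicator A ((1 / sqrt n) *\<^sub>R (\<Sum>i<n. u i), (1 / sqrt k) *\<^sub>R (\<Sum>i\<in>S. u i))
      \<partial>PiM {..<n} (\<lambda>_. std_gaussian :: (real ^ 'd) measure))"
    by (subst nn_integral_distr) simp_all
  also have "\<dots> = (\<integral>\<^sup>+u. H (\<Sum>i\<in>{..<n} \<inter> S. u i) (\<Sum>i\<in>{..<n} - S. u i) \<partial>PiM {..<n} (\<lambda>_. std_gaussian))"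
    using S by (simp add: H_def inter sum.subset_diff[of S "{..<n}"] add.commute)
  also have "\<dots> = (\<integral>\<^sup>+a. \<integral>\<^sup>+b. H (sqrt k *\<^sub>R a) (sqrt (n - k) *\<^sub>R b) \<partial>std_gaussian \<partial>std_gaussian)"
    by (subst nn_integral_PiM_std_gaussian_sums) (simp_all only: H_meas inter card_diff S finite_lessThan)
  also have "\<dots> = (\<integral>\<^sup>+a. \<integral>\<^sup>+b. (\<lambda>(x, y). indicator A (x, c *\<^sub>R x + s *\<^sub>R y))
      (c *\<^sub>R a + s *\<^sub>R b, s *\<^sub>R a - c *\<^sub>R b) \<partial>std_gaussian \<partial>std_gaussian)"
    using k by (simp only: H_def scaleR_add_right scaleR_scaleR c_eq s_eq prod.case
        refl_eq[unfolded scaleR_add_right scaleR_scaleR]) simp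
  also have "\<dots> = (\<integral>\<^sup>+a. \<integral>\<^sup>+b. (\<lambda>(x, y). indicator A (x, c *\<^sub>R x + s *\<^sub>R y)) (a, b) \<partial>std_gaussian \<partial>std_gaussian)"
    by (rule std_gaussian_reflection[OF _ cs]) measurable
  also have "\<dots> = (\<integral>\<^sup>+z. (\<lambda>(x, y). indicator A (x, c *\<^sub>R x + s *\<^sub>R y)) z \<partial>(std_gaussian \<Otimes>\<^sub>M std_gaussian))"
    by (rule M1.nn_integral_fst) measurable
  also have "\<dots> = (\<integral>\<^sup>+z. indicator A z \<partial>?R)"
    by (subst nn_integral_distr) (simp_all add: c_def s_def split_beta')
  also have "\<dots> = emeasure ?R A"
    by (rule nn_integral_indicator) simp
  finally show "emeasure ?L A = emeasure ?R A" .
qed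

lemma card_subsets_containing:
  assumes "finite A" "i \<in> A" "k > 0"
  shows "card {S. S \<subseteq> A \<and> card S = k \<and> i \<in> S} = (card A - 1) choose (k - 1)"
proof -
  have "bij_betw (insert i) {T. T \<subseteq> A - {i} \<and> card T = k - 1} {S. S \<subseteq> A \<and> card S = k \<and> i \<in> S}"
  proof (rule bij_betwI[where g = "\<lambda>S. S - {i}"])
    show "insert i \<in> {T. T \<subseteq> A - {i} \<and> card T = k - 1} \<rightarrow> {S. S \<subseteq> A \<and> card S = k \<and> i \<in> S}"
    proof safe
      fix T assume T: "T \<subseteq> A - {i}" "card T = k - 1"
      then have "finite T" "i \<notin> T" using assms(1) by (auto intro: finite_subset)
      with T assms show "card (insert i T) = k" by simp
    qed (use assms in auto)
  qed (use assms in \<open>auto simp: card_Diff_singleton\<close>)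
  then have "card {S. S \<subseteq> A \<and> card S = k \<and> i \<in> S} = card {T. T \<subseteq> A - {i} \<and> card T = k - 1}"
    by (simp add: bij_betw_same_card)
  then show ?thesis
    using assms by (simp add: n_subsets)
qed

text \<open>The exponential form of Gaussian hypercontractivity at rational \<open>r\<close>. Jensen's inequality for the conditional
  expectation given \<open>X\<close> is used in the form of the tangent inequality \<open>exp v \<ge> exp x (1 + v - x)\<close>, in which only
  the laws of the pairs \<open>(X, W S)\<close> enter, and not the joint law of all \<open>W S\<close>.\<close>

lemma exp_hypercontractivity_rational:
  fixes f :: "real ^ 'd::finite \<Rightarrow> real"
  assumes f [measurable]: "f \<in> borel_measurable borel" and bound: "\<And>x. \<bar>f x\<bar> \<le> C"
    and k: "0 < k" "k \<le> n"
  defines "r \<equiv> real k / real n"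
  shows "(\<integral>a. exp ((\<integral>b. f (sqrt r *\<^sub>R a + sqrt (1 - r) *\<^sub>R b) \<partial>std_gaussian) / r) \<partial>std_gaussian)
    \<le> exp (ln (\<integral>a. exp (f a) \<partial>std_gaussian) / r)"
proof -
  interpret \<gamma>: pair_prob_space "std_gaussian :: (real ^ 'd) measure" "std_gaussian :: (real ^ 'd) measure"
    by (rule pair_prob_space_std_gaussian)
  let ?P = "PiM {..<n} (\<lambda>_. std_gaussian :: (real ^ 'd) measure)"
  interpret P: prob_space ?P
    by (intro prob_space_PiM prob_space_std_gaussian)
  have n: "n > 0" using k by simp
  have r: "0 < r" using k by (simp add: r_def)
  define J where "J = {S. S \<subseteq> {..<n} \<and> card S = k}"
  define c where "c = (n - 1) choose (k - 1)"
  have finJ: "finite J" unfolding J_def by (rule finite_subset[of _ "Pow {..<n}"]) auto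
  have c: "c > 0" unfolding c_def using k by (simp add: zero_less_binomial_iff)
  have "real (card J) / c = 1 / r"
  proof -
    have "card J = n choose k" by (simp add: J_def n_subsets)
    moreover have "k * (n choose k) = n * c"
      using k unfolding c_def by (metis Suc_pred' binomial_absorption less_le_trans)
    then have "real k * real (n choose k) = real n * real c"
      by (simp only: of_nat_mult[symmetric])
    ultimately show ?thesis
      using k n c by (simp add: r_def field_simps)
  qed
  note ratio = this
  define G where "G a = (\<integral>b. f (sqrt r *\<^sub>R a + sqrt (1 - r) *\<^sub>R b) \<partial>std_gaussian)" for a
  have [measurable]: "G \<in> borel_measurable borel"
    unfolding G_def by measurable
  have f_int: "integrable std_gaussian (\<lambda>b. f (a + x *\<^sub>R b))" for a x
    by (rule integrable_std_gaussian_bounded[of _ C]) (simp_all add: bound)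
  have f_le: "- C \<le> f x" "f x \<le> C" for x using bound[of x] by auto
  have G_bound: "\<bar>G a\<bar> \<le> C" for a
  proof -
    have "G a \<le> C" "- C \<le> G a"
      unfolding G_def
      by (rule \<gamma>.M1.integral_le_const[OF f_int] \<gamma>.M1.integral_ge_const[OF f_int], simp add: f_le)+
    then show ?thesis by auto
  qed
  have [simp]: "C \<ge> 0" using bound[of 0] by linarith
  define X :: "(nat \<Rightarrow> real ^ 'd) \<Rightarrow> real ^ 'd" where "X u = (1 / sqrt n) *\<^sub>R (\<Sum>i<n. u i)" for u
  define W :: "nat set \<Rightarrow> (nat \<Rightarrow> real ^ 'd) \<Rightarrow> real ^ 'd"
    where "W S u = (1 / sqrt k) *\<^sub>R (\<Sum>i\<in>{..<n} \<inter> S. u i)" for S u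
  have [measurable]: "X \<in> borel_measurable ?P" "W S \<in> borel_measurable ?P" for S
    unfolding X_def W_def by measurable
  have XW: "distr ?P (borel \<Otimes>\<^sub>M borel) (\<lambda>u. (X u, W S u))
      = distr (std_gaussian \<Otimes>\<^sub>M std_gaussian) (borel \<Otimes>\<^sub>M borel)
          (\<lambda>(a, b). (a, sqrt r *\<^sub>R a + sqrt (1 - r) *\<^sub>R b))" if "S \<in> J" for S
  proof -
    have "S \<subseteq> {..<n}" "card S = k" using that by (auto simp: J_def)
    then show ?thesis
      using distr_PiM_std_gaussian_total_partial[OF k, of S, where 'd = 'd]
      by (simp add: X_def W_def[abs_def] r_def Int_absorb1)
  qed
  have joint: "(\<integral>u. K (X u) (W S u) \<partial>?P)
      = (\<integral>a. (\<integral>b. K a (sqrt r *\<^sub>R a + sqrt (1 - r) *\<^sub>R b) \<partial>std_gaussian) \<partial>std_gaussian)"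
    if S: "S \<in> J" and K: "case_prod K \<in> borel_measurable (borel \<Otimes>\<^sub>M borel)" and Kb: "\<And>x y. \<bar>K x y\<bar> \<le> D"
    for S D and K :: "real ^ 'd \<Rightarrow> real ^ 'd \<Rightarrow> real"
  proof -
    note K [measurable]
    have "(\<integral>u. K (X u) (W S u) \<partial>?P) = (\<integral>z. case_prod K z \<partial>distr ?P (borel \<Otimes>\<^sub>M borel) (\<lambda>u. (X u, W S u)))"
      by (subst integral_distr) auto
    also have "\<dots> = (\<integral>z. (\<lambda>(a, b). K a (sqrt r *\<^sub>R a + sqrt (1 - r) *\<^sub>R b)) z \<partial>(std_gaussian \<Otimes>\<^sub>M std_gaussian))"
      unfolding XW[OF S] by (subst integral_distr) (auto simp: split_beta')
    also have "\<dots> = (\<integral>a. (\<integral>b. K a (sqrt r *\<^sub>R a + sqrt (1 - r) *\<^sub>R b) \<partial>std_gaussian) \<partial>std_gaussian)"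
      by (subst \<gamma>.integral_fst'[symmetric])
         (auto intro!: \<gamma>.P.integrable_const_bound[where B = D] simp: Kb split_beta')
    finally show ?thesis .
  qed
  have "card J > 0" using ratio r c by (metis divide_eq_0_iff gr0I less_numeral_extra(3) of_nat_0 zero_less_divide_1_iff)
  then obtain S0 where S0: "S0 \<in> J" by (auto simp: card_gt_0_iff)
  have X_law: "(\<integral>u. h (X u) \<partial>?P) = (\<integral>a. h a \<partial>std_gaussian)"
    if [measurable]: "h \<in> borel_measurable borel" and "\<And>x. \<bar>h x\<bar> \<le> D" for h :: "real ^ 'd \<Rightarrow> real" and D
    using joint[OF S0, of "\<lambda>x _. h x" D] that(2) \<gamma>.M1.prob_space by simp
  define w where "w a = exp (G a / r)" for a
  have [measurable]: "w \<in> borel_measurable borel" unfolding w_def by measurable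
  have w_bound: "0 \<le> w a" "w a \<le> exp (C / r)" for a
    using G_bound[of a] r by (auto simp: w_def divide_right_mono abs_le_iff)
  define v where "v u = (\<Sum>S\<in>J. f (W S u)) / c" for u
  have [measurable]: "v \<in> borel_measurable ?P" unfolding v_def by measurable
  have wf_bound: "\<bar>w x * f y\<bar> \<le> exp (C / r) * C" "\<bar>w x * G y\<bar> \<le> exp (C / r) * C" for x y
    using w_bound bound G_bound by (auto simp: abs_mult intro!: mult_mono)
  have int_w: "integrable ?P (\<lambda>u. w (X u))"
    by (rule P.integrable_const_bound[where B = "exp (C / r)"]) (use w_bound in auto)
  have int_wf: "integrable ?P (\<lambda>u. w (X u) * f (W S u))" for S
    by (rule P.integrable_const_bound[where B = "exp (C / r) * C"]) (use wf_bound in auto)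
  have int_wG: "integrable ?P (\<lambda>u. w (X u) * G (X u))"
    by (rule P.integrable_const_bound[where B = "exp (C / r) * C"]) (use wf_bound in auto)
  have wf: "(\<integral>u. w (X u) * f (W S u) \<partial>?P) = (\<integral>a. w a * G a \<partial>std_gaussian)" if "S \<in> J" for S
    by (subst joint[OF that _ wf_bound(1)]) (simp_all add: G_def)
  have wv: "w (X u) * v u = (\<Sum>S\<in>J. w (X u) * f (W S u)) / c" for u
    by (simp add: v_def sum_distrib_left)
  have int_wv: "integrable ?P (\<lambda>u. w (X u) * v u)"
    unfolding wv by (intro integrable_divide Bochner_Integration.integrable_sum int_wf)
  have "(\<integral>u. w (X u) * v u \<partial>?P) = (\<Sum>S\<in>J. \<integral>u. w (X u) * f (W S u) \<partial>?P) / c"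
    unfolding wv by (simp add: Bochner_Integration.integral_sum int_wf)
  also have "\<dots> = (real (card J) / c) * (\<integral>a. w a * G a \<partial>std_gaussian)"
    by (simp add: wf)
  also have "\<dots> = (\<integral>u. w (X u) * (G (X u) / r) \<partial>?P)"
    using X_law[of "\<lambda>a. w a * G a" "exp (C / r) * C"] wf_bound by (simp add: ratio)
  finally have wv_eq: "(\<integral>u. w (X u) * v u \<partial>?P) = (\<integral>u. w (X u) * (G (X u) / r) \<partial>?P)" .
  have v_bound: "v u \<le> C / r" for u
  proof -
    have "(\<Sum>S\<in>J. f (W S u)) \<le> real (card J) * C"
      using sum_bounded_above[of J "\<lambda>S. f (W S u)" C] f_le by simp
    then have "v u \<le> real (card J) / c * C"
      using c by (simp add: v_def divide_right_mono)
    then show ?thesis by (simp add: ratio)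
  qed
  have int_v: "integrable ?P (\<lambda>u. exp (v u))"
    by (rule P.integrable_const_bound[where B = "exp (C / r)"]) (use v_bound in auto)
  \<comment> \<open>By \<open>wv_eq\<close> the last two terms on the left cancel in expectation.\<close>
  have tangent: "w (X u) + w (X u) * v u - w (X u) * (G (X u) / r) \<le> exp (v u)" for u
  proof -
    have "w (X u) * (1 + (v u - G (X u) / r)) \<le> w (X u) * exp (v u - G (X u) / r)"
      by (intro mult_left_mono w_bound exp_ge_add_one_self)
    also have "\<dots> = exp (v u)" by (simp add: w_def exp_diff)
    finally show ?thesis by (simp add: algebra_simps)
  qed
  have int_wG': "integrable ?P (\<lambda>u. w (X u) * (G (X u) / r))"
    using integrable_divide[OF int_wG, of r] by simp
  have "(\<integral>a. w a \<partial>std_gaussian) = (\<integral>u. w (X u) \<partial>?P)"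
    by (rule X_law[symmetric, where D = "exp (C / r)"]) (use w_bound in auto)
  also have "\<dots> = (\<integral>u. w (X u) + w (X u) * v u - w (X u) * (G (X u) / r) \<partial>?P)"
    using int_w int_wv int_wG' wv_eq by simp
  also have "\<dots> \<le> (\<integral>u. exp (v u) \<partial>?P)"
    by (rule integral_mono[OF _ int_v tangent])
       (intro Bochner_Integration.integrable_add Bochner_Integration.integrable_diff int_w int_wv int_wG')
  finally have le_v: "(\<integral>a. w a \<partial>std_gaussian) \<le> (\<integral>u. exp (v u) \<partial>?P)" .
  have "ennreal (\<integral>u. exp (v u) \<partial>?P)
        = (\<integral>\<^sup>+u. ennreal (exp ((\<Sum>S\<in>J. f ((1 / sqrt k) *\<^sub>R (\<Sum>i\<in>{..<n} \<inter> S. u i))) / c)) \<partial>?P)"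
      by (subst nn_integral_eq_integral[symmetric]) (use int_v in \<open>simp_all add: v_def W_def\<close>)
    also have "\<dots> \<le> ennreal (exp ((\<Sum>S\<in>J. ln (\<integral>a. exp (f ((1 / sqrt k) *\<^sub>R (sqrt (card ({..<n} \<inter> S)) *\<^sub>R a))) \<partial>std_gaussian)) / c))"
    proof (rule finner_inequality_std_gaussian[of "{..<n}" J c "\<lambda>S. S" "\<lambda>_ x. f ((1 / sqrt k) *\<^sub>R x)" C])
      show "card {S \<in> J. i \<in> S} = c" if "i \<in> {..<n}" for i
        using card_subsets_containing[of "{..<n}" i k] that k
        by (simp add: J_def c_def conj_assoc)
    qed (use finJ c bound in auto)
    also have "(\<Sum>S\<in>J. ln (\<integral>a. exp (f ((1 / sqrt k) *\<^sub>R (sqrt (card ({..<n} \<inter> S)) *\<^sub>R a))) \<partial>std_gaussian)) / c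
        = (\<Sum>S\<in>J. ln (\<integral>a. exp (f a) \<partial>std_gaussian)) / c"
      using k by (intro arg_cong2[where f = "(/)"] sum.cong refl) (auto simp: J_def Int_absorb1)
    also have "\<dots> = (real (card J) / c) * ln (\<integral>a. exp (f a) \<partial>std_gaussian)"
      by simp
    finally have "(\<integral>u. exp (v u) \<partial>?P) \<le> exp (ln (\<integral>a. exp (f a) \<partial>std_gaussian) / r)"
      by (simp add: ratio)
  with le_v show ?thesis
    by (simp add: w_def G_def)
qed

section \<open>The Markov property for the augmented filtration\<close>

lemma sets_Collect_mem:
  assumes "f \<in> measurable M N" "A \<in> sets N"
  shows "{x \<in> space M. f x \<in> A} \<in> sets M"
  using measurable_sets[OF assms] by (simp add: vimage_def Int_def conj_commute)

context standard_brownian_motion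
begin

text \<open>Independence of finitely many values up to time \<open>t\<close> and a later increment. The times are refined to a strictly
  increasing sequence from 0 to \<open>t\<close> followed by \<open>u\<close>, and the values are written as sums of the
  increments over this sequence.\<close>

lemma indep_cylinder_increment:
  assumes t: "0 \<le> t" "t < u" and T: "finite T" "T \<subseteq> {0..t}"
    and A: "\<And>s. s \<in> T \<Longrightarrow> A s \<in> sets borel" and D: "D \<in> sets borel"
  shows "prob ({\<omega> \<in> space M. \<forall>s\<in>T. B s \<omega> \<in> A s} \<inter> {\<omega> \<in> space M. B u \<omega> - B t \<omega> \<in> D})
    = prob {\<omega> \<in> space M. \<forall>s\<in>T. B s \<omega> \<in> A s} * prob {\<omega> \<in> space M. B u \<omega> - B t \<omega> \<in> D}"
proof -
  note D [measurable] and measurable_B [measurable]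
  define xs where "xs = sorted_list_of_set (insert 0 (insert t T))"
  define m where "m = length xs - 1"
  have fin: "finite (insert 0 (insert t T))" using T by simp
  have set_xs: "set xs = insert 0 (insert t T)" and sorted: "sorted_wrt (<) xs"
    unfolding xs_def by (rule set_sorted_list_of_set[OF fin]) (rule strict_sorted_list_of_set)
  have range_xs: "set xs \<subseteq> {0..t}" using T t by (auto simp: set_xs)
  have "xs \<noteq> []" using set_xs by auto
  then have len: "length xs = Suc m" by (simp add: m_def)
  define \<tau> where "\<tau> i = (if i \<le> m then xs ! i else u)" for i
  have mono: "\<tau> i < \<tau> (Suc i)" if "i < Suc m" for i
  proof (cases "i < m")
    case True
    then show ?thesis
      using sorted_wrt_nth_less[OF sorted, of i "Suc i"] len by (simp add: \<tau>_def)
  next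
    case False
    with that have "i = m" by simp
    moreover have "xs ! m \<in> set xs" using len by simp
    ultimately show ?thesis using range_xs t by (auto simp: \<tau>_def)
  qed
  have \<tau>_in: "\<tau> i \<in> {0..t}" if "i \<le> m" for i
  proof -
    have "xs ! i \<in> set xs" using that len by simp
    then show ?thesis using that range_xs by (auto simp: \<tau>_def)
  qed
  have le: "\<tau> i \<le> \<tau> j" if "i \<le> j" "j \<le> m" for i j
    using that sorted len by (auto simp: \<tau>_def strict_sorted_iff intro: sorted_nth_mono)
  have ex_idx: "\<exists>i\<le>m. \<tau> i = s" if "s \<in> set xs" for s
    using that len by (auto simp: in_set_conv_nth \<tau>_def)
  have \<tau>0: "\<tau> 0 = 0"
  proof -
    obtain i where "i \<le> m" "\<tau> i = 0" using ex_idx[of 0] set_xs by auto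
    then show ?thesis using le[of 0 i] \<tau>_in[of 0] by auto
  qed
  have \<tau>m: "\<tau> m = t"
  proof -
    obtain i where "i \<le> m" "\<tau> i = t" using ex_idx[of t] set_xs by auto
    then show ?thesis using le[of i m] \<tau>_in[of m] by auto
  qed
  have \<tau>Suc: "\<tau> (Suc m) = u" by (simp add: \<tau>_def)
  define inc where "inc i \<omega> = B (\<tau> (Suc i)) \<omega> - B (\<tau> i) \<omega>" for i \<omega>
  have "indep_vars (\<lambda>_. borel) inc {..<Suc m}"
    unfolding inc_def[abs_def] by (rule indep_increments) (use \<tau>0 mono in auto)
  then have indep: "indep_var (PiM {..<m} (\<lambda>_. borel)) (\<lambda>\<omega>. restrict (\<lambda>i. inc i \<omega>) {..<m})
      (PiM {m} (\<lambda>_. borel)) (\<lambda>\<omega>. restrict (\<lambda>i. inc i \<omega>) {m})"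
    by (rule indep_var_restrict) auto
  obtain idx where idx: "\<And>s. s \<in> T \<Longrightarrow> idx s \<le> m \<and> \<tau> (idx s) = s"
    using ex_idx set_xs by (metis insertCI)
  have tele: "(\<Sum>j<idx s. inc j \<omega>) = B s \<omega> - B 0 \<omega>" if "s \<in> T" for s \<omega>
    using idx[OF that] \<tau>0 sum_lessThan_telescope[of "\<lambda>j. B (\<tau> j) \<omega>" "idx s"] by (simp add: inc_def)
  define E where "E = {v \<in> space (PiM {..<m} (\<lambda>_. borel :: (real ^ 'd) measure)). \<forall>s\<in>T. (\<Sum>j<idx s. v j) \<in> A s}"
  have E: "E \<in> sets (PiM {..<m} (\<lambda>_. borel))"
    unfolding E_def
  proof (rule sets.sets_Collect_finite_All[OF _ T(1)])
    fix s assume s: "s \<in> T"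
    have "(\<lambda>v. \<Sum>j<idx s. v j) \<in> borel_measurable (PiM {..<m} (\<lambda>_. borel :: (real ^ 'd) measure))"
      using idx[OF s] by (intro borel_measurable_sum measurable_component_singleton) auto
    then show "{v \<in> space (PiM {..<m} (\<lambda>_. borel)). (\<Sum>j<idx s. v j) \<in> A s} \<in> sets (PiM {..<m} (\<lambda>_. borel))"
      using A[OF s] by (rule sets_Collect_mem)
  qed
  define F where "F = {v \<in> space (PiM {m} (\<lambda>_. borel :: (real ^ 'd) measure)). v m \<in> D}"
  have F: "F \<in> sets (PiM {m} (\<lambda>_. borel))"
    unfolding F_def by measurable
  have preE: "(\<lambda>\<omega>. restrict (\<lambda>i. inc i \<omega>) {..<m}) -` E \<inter> space M
      = {\<omega> \<in> space M. \<forall>s\<in>T. B s \<omega> - B 0 \<omega> \<in> A s}"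
  proof -
    have "(\<Sum>j<idx s. restrict (\<lambda>i. inc i \<omega>) {..<m} j) = B s \<omega> - B 0 \<omega>" if "s \<in> T" for s \<omega>
    proof -
      have "(\<Sum>j<idx s. restrict (\<lambda>i. inc i \<omega>) {..<m} j) = (\<Sum>j<idx s. inc j \<omega>)"
        using idx[OF that] by (intro sum.cong) auto
      then show ?thesis using tele[OF that] by simp
    qed
    then show ?thesis by (auto simp: E_def space_PiM)
  qed
  have preF: "(\<lambda>\<omega>. restrict (\<lambda>i. inc i \<omega>) {m}) -` F \<inter> space M = {\<omega> \<in> space M. B u \<omega> - B t \<omega> \<in> D}"
    by (auto simp: F_def space_PiM inc_def \<tau>m \<tau>Suc)
  have m1 [measurable]: "{\<omega> \<in> space M. \<forall>s\<in>T. B s \<omega> \<in> A s} \<in> events"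
    "{\<omega> \<in> space M. \<forall>s\<in>T. B s \<omega> - B 0 \<omega> \<in> A s} \<in> events"
  proof -
    have "B s \<in> borel_measurable M" "(\<lambda>\<omega>. B s \<omega> - B 0 \<omega>) \<in> borel_measurable M" if "s \<in> T" for s
      using that T by (auto intro!: measurable_B borel_measurable_diff)
    then show "{\<omega> \<in> space M. \<forall>s\<in>T. B s \<omega> \<in> A s} \<in> events"
      "{\<omega> \<in> space M. \<forall>s\<in>T. B s \<omega> - B 0 \<omega> \<in> A s} \<in> events"
      by (auto intro!: sets.sets_Collect_finite_All[OF _ T(1)] sets_Collect_mem[where N = borel] A)
  qed
  have m2 [measurable]: "{\<omega> \<in> space M. B u \<omega> - B t \<omega> \<in> D} \<in> events"
    using t by (intro sets_Collect_mem[where N = borel] borel_measurable_diff measurable_B D) auto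
  \<comment> \<open>Sums of increments give \<open>B s - B 0\<close>, which is \<open>B s\<close> only almost surely.\<close>
  have "prob {\<omega> \<in> space M. \<forall>s\<in>T. B s \<omega> \<in> A s} = prob {\<omega> \<in> space M. \<forall>s\<in>T. B s \<omega> - B 0 \<omega> \<in> A s}"
    by (rule finite_measure_eq_AE) (use start_origin m1 in auto)
  moreover have "prob ({\<omega> \<in> space M. \<forall>s\<in>T. B s \<omega> \<in> A s} \<inter> {\<omega> \<in> space M. B u \<omega> - B t \<omega> \<in> D})
      = prob ({\<omega> \<in> space M. \<forall>s\<in>T. B s \<omega> - B 0 \<omega> \<in> A s} \<inter> {\<omega> \<in> space M. B u \<omega> - B t \<omega> \<in> D})"
    by (rule finite_measure_eq_AE) (use start_origin m1 m2 in auto)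
  moreover have "prob ({\<omega> \<in> space M. \<forall>s\<in>T. B s \<omega> - B 0 \<omega> \<in> A s} \<inter> {\<omega> \<in> space M. B u \<omega> - B t \<omega> \<in> D})
      = prob {\<omega> \<in> space M. \<forall>s\<in>T. B s \<omega> - B 0 \<omega> \<in> A s} * prob {\<omega> \<in> space M. B u \<omega> - B t \<omega> \<in> D}"
  proof -
    have "(\<lambda>\<omega>. (restrict (\<lambda>i. inc i \<omega>) {..<m}, restrict (\<lambda>i. inc i \<omega>) {m})) -` (E \<times> F) \<inter> space M
      = {\<omega> \<in> space M. \<forall>s\<in>T. B s \<omega> - B 0 \<omega> \<in> A s} \<inter> {\<omega> \<in> space M. B u \<omega> - B t \<omega> \<in> D}"
      unfolding preE[symmetric] preF[symmetric] by auto
    then show ?thesis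
      using indep_varD[OF indep E F] by (simp only: preE preF)
  qed
  ultimately show ?thesis by simp
qed

lemma space_augmented_filtration [simp]: "space (augmented_filtration M B t) = space M"
  using subalgebra_augmented_filtration by (simp add: subalgebra_def)

lemma null_sets_subset_Pow: "null_sets M \<subseteq> Pow (space M)"
  using sets.sets_into_space by blast

lemma measurable_augmented_filtration:
  assumes "0 \<le> s" "s \<le> t"
  shows "B s \<in> borel_measurable (augmented_filtration M B t)"
proof (rule measurableI)
  fix C :: "(real ^ 'd) set" assume "C \<in> sets borel"
  let ?G = "{B s -` A \<inter> space M | s A. 0 \<le> s \<and> s \<le> t \<and> A \<in> sets borel} \<union> null_sets M"
  have "?G \<subseteq> Pow (space M)"
    using null_sets_subset_Pow by auto
  moreover have "B s -` C \<inter> space M \<in> ?G"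
    using assms \<open>C \<in> sets borel\<close> by blast
  ultimately show "B s -` C \<inter> space (augmented_filtration M B t) \<in> sets (augmented_filtration M B t)"
    unfolding space_augmented_filtration by (simp add: augmented_filtration_def)
qed simp

text \<open>The cylinder events up to time \<open>t\<close> together with the null events form an intersection-stable generator of
  the augmented \<open>\<sigma>\<close>-algebra, and both kinds of events are independent of the increment.\<close>

lemma indep_set_augmented_filtration_increment:
  assumes t: "0 \<le> t" "t < u"
  shows "indep_set (sets (augmented_filtration M B t))
    (sigma_sets (space M) {(\<lambda>\<omega>. B u \<omega> - B t \<omega>) -` A \<inter> space M | A. A \<in> sets borel})"
proof -
  define C where "C = {{\<omega> \<in> space M. \<forall>s\<in>T. B s \<omega> \<in> A s} | T A.
      finite T \<and> T \<subseteq> {0..t} \<and> (\<forall>s. A s \<in> sets (borel :: (real ^ 'd) measure))}"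
  define \<D> where "\<D> = {(\<lambda>\<omega>. B u \<omega> - B t \<omega>) -` A \<inter> space M | A. A \<in> sets borel}"
  have inc [measurable]: "(\<lambda>\<omega>. B u \<omega> - B t \<omega>) \<in> borel_measurable M"
    using t by (intro borel_measurable_diff measurable_B) auto
  have C_events: "C \<subseteq> events"
  proof
    fix a assume "a \<in> C"
    then obtain T A where "a = {\<omega> \<in> space M. \<forall>s\<in>T. B s \<omega> \<in> A s}" and T: "finite T" "T \<subseteq> {0..t}"
      and A: "\<And>s. A s \<in> sets borel" unfolding C_def by blast
    moreover have "{\<omega> \<in> space M. B s \<omega> \<in> A s} \<in> events" if "s \<in> T" for s
      using that T A measurable_B[of s] by (intro sets_Collect_mem) auto
    ultimately show "a \<in> events" by (simp add: sets.sets_Collect_finite_All)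
  qed
  have D_events: "\<D> \<subseteq> events"
    by (auto simp: \<D>_def)
  have C_Int: "a \<inter> b \<in> C" if "a \<in> C" "b \<in> C" for a b
  proof -
    obtain T A where a: "a = {\<omega> \<in> space M. \<forall>s\<in>T. B s \<omega> \<in> A s}" "finite T" "T \<subseteq> {0..t}"
      and A: "\<And>s. A s \<in> sets borel" using \<open>a \<in> C\<close> unfolding C_def by blast
    obtain T' A' where b: "b = {\<omega> \<in> space M. \<forall>s\<in>T'. B s \<omega> \<in> A' s}" "finite T'" "T' \<subseteq> {0..t}"
      and A': "\<And>s. A' s \<in> sets borel" using \<open>b \<in> C\<close> unfolding C_def by blast
    let ?A = "\<lambda>s. (if s \<in> T then A s else UNIV) \<inter> (if s \<in> T' then A' s else UNIV)"
    have "a \<inter> b = {\<omega> \<in> space M. \<forall>s\<in>T \<union> T'. B s \<omega> \<in> ?A s}"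
      using a b by auto
    moreover have "finite (T \<union> T')" "T \<union> T' \<subseteq> {0..t}" "\<forall>s. ?A s \<in> sets borel"
      using a b A A' by auto
    ultimately show ?thesis
      unfolding C_def by (intro CollectI exI[of _ "T \<union> T'"] exI[of _ ?A] conjI)
  qed
  have null_Int: "a \<inter> b \<in> null_sets M" if "a \<in> null_sets M" "b \<in> events" for a b
    using that by (simp add: null_set_Int2)
  have "Int_stable (C \<union> null_sets M)"
  proof (rule Int_stableI)
    fix a b assume "a \<in> C \<union> null_sets M" "b \<in> C \<union> null_sets M"
    then consider "a \<in> C" "b \<in> C" | "a \<in> null_sets M" "b \<in> events" | "b \<in> null_sets M" "a \<in> events"
      using C_events by blast
    then show "a \<inter> b \<in> C \<union> null_sets M"
      by cases (use C_Int null_Int[of a b] null_Int[of b a] in \<open>auto simp: Int_commute\<close>)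
  qed
  moreover have "Int_stable \<D>"
  proof (rule Int_stableI)
    fix a b assume "a \<in> \<D>" "b \<in> \<D>"
    then obtain A A' where "a = (\<lambda>\<omega>. B u \<omega> - B t \<omega>) -` A \<inter> space M" "A \<in> sets borel"
      "b = (\<lambda>\<omega>. B u \<omega> - B t \<omega>) -` A' \<inter> space M" "A' \<in> sets borel" unfolding \<D>_def by blast
    then have "a \<inter> b = (\<lambda>\<omega>. B u \<omega> - B t \<omega>) -` (A \<inter> A') \<inter> space M" "A \<inter> A' \<in> sets borel" by auto
    then show "a \<inter> b \<in> \<D>" unfolding \<D>_def by blast
  qed
  moreover have "indep_set (C \<union> null_sets M) \<D>"
    unfolding indep_sets2_eq
  proof (intro conjI ballI)
    show "C \<union> null_sets M \<subseteq> events" using C_events by auto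
    show "\<D> \<subseteq> events" by (rule D_events)
    fix a b assume a: "a \<in> C \<union> null_sets M" and b: "b \<in> \<D>"
    then show "prob (a \<inter> b) = prob a * prob b"
    proof (elim UnE)
      assume "a \<in> C"
      then obtain T A where "a = {\<omega> \<in> space M. \<forall>s\<in>T. B s \<omega> \<in> A s}" "finite T" "T \<subseteq> {0..t}"
        "\<And>s. A s \<in> sets borel" unfolding C_def by blast
      moreover obtain D where "b = {\<omega> \<in> space M. B u \<omega> - B t \<omega> \<in> D}" "D \<in> sets borel"
        using b unfolding \<D>_def by (auto simp: vimage_def Int_def conj_commute)
      ultimately show ?thesis
        using indep_cylinder_increment[OF t, of T A D] by simp
    next
      assume "a \<in> null_sets M"
      moreover from this b D_events have "a \<inter> b \<in> null_sets M" by (intro null_Int) auto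
      ultimately show ?thesis by (simp add: measure_eq_0_null_sets)
    qed
  qed
  ultimately have indep: "indep_set (sigma_sets (space M) (C \<union> null_sets M)) (sigma_sets (space M) \<D>)"
    by (intro indep_set_sigma_sets)
  have "sets (augmented_filtration M B t) \<subseteq> sigma_sets (space M) (C \<union> null_sets M)"
  proof -
    let ?G = "{B s -` A \<inter> space M | s A. 0 \<le> s \<and> s \<le> t \<and> A \<in> sets borel} \<union> null_sets M"
    have "?G \<subseteq> C \<union> null_sets M"
    proof -
      have "B s -` A \<inter> space M \<in> C" if "0 \<le> s" "s \<le> t" "A \<in> sets borel" for s A
      proof -
        have "B s -` A \<inter> space M = {\<omega> \<in> space M. \<forall>r\<in>{s}. B r \<omega> \<in> A}" by auto
        then show ?thesis unfolding C_def using that by (intro CollectI exI[of _ "{s}"] exI[of _ "\<lambda>_. A"]) simp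
      qed
      then show ?thesis by blast
    qed
    moreover have "?G \<subseteq> Pow (space M)"
      using null_sets_subset_Pow by auto
    ultimately show ?thesis
      by (simp add: augmented_filtration_def sets_measure_of sigma_sets_mono' del: Un_subset_iff)
  qed
  with indep show ?thesis
    unfolding indep_sets2_eq \<D>_def by blast
qed

lemma distr_marginal:
  assumes "0 < t"
  shows "distr M borel (B t) = distr std_gaussian borel (\<lambda>x. sqrt t *\<^sub>R x)"
proof -
  have "distr M borel (B t) = distr M borel (\<lambda>\<omega>. B t \<omega> - B 0 \<omega>)"
    using start_origin assms
    by (intro distr_cong_AE) (auto intro!: measurable_B borel_measurable_diff)
  then show ?thesis
    using gaussian_increments[of 0 t] assms by simp
qed


sublocale filtration: sigma_finite_subalgebra M "augmented_filtration M B t" for t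
proof -
  interpret finite_measure_subalgebra M "augmented_filtration M B t"
    by unfold_locales (rule subalgebra_augmented_filtration)
  show "sigma_finite_subalgebra M (augmented_filtration M B t)"
    by unfold_locales
qed

text \<open>The Markov property: conditioning on the augmented \<open>\<sigma>\<close>-algebra amounts to averaging over the independent increment.
  The Gaussian integral of the unbounded \<open>f\<close> exists for almost every value of \<open>B t\<close>; elsewhere it is 0
  by convention.\<close>

lemma cond_exp_augmented_filtration:
  fixes f :: "real ^ 'd \<Rightarrow> real"
  assumes t: "0 \<le> t" "t < u" and f [measurable]: "f \<in> borel_measurable borel"
    and int: "integrable M (\<lambda>\<omega>. f (B u \<omega>))"
  shows "AE \<omega> in M. integrable std_gaussian (\<lambda>z. f (B t \<omega> + sqrt (u - t) *\<^sub>R z))"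
    and "AE \<omega> in M. real_cond_exp M (augmented_filtration M B t) (\<lambda>\<omega>. f (B u \<omega>)) \<omega>
        = (\<integral>z. f (B t \<omega> + sqrt (u - t) *\<^sub>R z) \<partial>std_gaussian)"
proof -
  let ?F = "augmented_filtration M B t"
  let ?D = "\<lambda>\<omega>. B u \<omega> - B t \<omega>"
  have [measurable]: "B t \<in> borel_measurable ?F"
    using t by (intro measurable_augmented_filtration) auto
  have [measurable]: "B t \<in> borel_measurable M" "B u \<in> borel_measurable M"
    using t by (auto intro: measurable_B)
  have sets_F: "sets ?F \<subseteq> events"
    using subalgebra_augmented_filtration by (simp add: subalgebra_def)
  have id [measurable]: "(\<lambda>\<omega>. \<omega>) \<in> measurable M ?F"
    by (rule measurableI) (use sets_F sets.sets_into_space in \<open>auto simp: Int_absorb2 Int_absorb1\<close>)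
  define N1 N2 where "N1 = distr M ?F (\<lambda>\<omega>. \<omega>)" and "N2 = distr M borel ?D"
  have N2: "N2 = distr std_gaussian borel (\<lambda>x. sqrt (u - t) *\<^sub>R x)"
    unfolding N2_def by (rule gaussian_increments[OF t])
  interpret N1: prob_space N1 unfolding N1_def by (rule prob_space_distr) simp
  interpret N2: prob_space N2 unfolding N2_def by (rule prob_space_distr) simp
  interpret N: pair_prob_space N1 N2 by unfold_locales
  have [measurable_cong]: "sets N1 = sets ?F" "sets N2 = sets borel"
    by (simp_all add: N1_def N2_def)
  \<comment> \<open>Independence is expressed as a product law of the outcome itself, seen in the smaller \<open>\<sigma>\<close>-algebra, and the increment.\<close>
  have joint: "N1 \<Otimes>\<^sub>M N2 = distr M (?F \<Otimes>\<^sub>M borel) (\<lambda>\<omega>. (\<omega>, ?D \<omega>))"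
  proof (rule pair_measure_eqI)
    fix A C assume "A \<in> sets N1" "C \<in> sets N2"
    then have A: "A \<in> sets ?F" and C: "C \<in> sets borel" by (simp_all add: N1_def N2_def)
    have A_events: "A \<in> events" using A sets_F by auto
    have C_events: "?D -` C \<inter> space M \<in> events" using C by simp
    have "?D -` C \<inter> space M \<in> sigma_sets (space M) {?D -` A \<inter> space M | A. A \<in> sets borel}"
      using C by (intro sigma_sets.Basic) blast
    then have "prob (A \<inter> (?D -` C \<inter> space M)) = prob A * prob (?D -` C \<inter> space M)"
      using indep_set_augmented_filtration_increment[OF t] A
      unfolding indep_sets2_eq by blast
    moreover have "(\<lambda>\<omega>. (\<omega>, ?D \<omega>)) -` (A \<times> C) \<inter> space M = A \<inter> (?D -` C \<inter> space M)"
      by auto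
    moreover have "A \<inter> space M = A" using sets.sets_into_space[OF A_events] by auto
    ultimately show "emeasure N1 A * emeasure N2 C
        = emeasure (distr M (?F \<Otimes>\<^sub>M borel) (\<lambda>\<omega>. (\<omega>, ?D \<omega>))) (A \<times> C)"
      using A C by (simp add: N1_def N2_def emeasure_distr emeasure_eq_measure ennreal_mult'')
  qed (use N1.sigma_finite_measure_axioms N2.sigma_finite_measure_axioms in \<open>simp_all add: N1_def N2_def\<close>)
  define h where "h = (\<lambda>(\<omega>, d). f (B t \<omega> + d))"
  have h [measurable]: "h \<in> borel_measurable (?F \<Otimes>\<^sub>M borel)"
    unfolding h_def by measurable
  have h_inc: "h (\<omega>, ?D \<omega>) = f (B u \<omega>)" for \<omega> by (simp add: h_def)
  have int_h: "integrable (N1 \<Otimes>\<^sub>M N2) h"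
    unfolding joint
    by (subst integrable_distr_eq) (simp_all add: h_inc int)
  have transfer: "integrable N2 (\<lambda>d. h (\<omega>, d)) \<longleftrightarrow> integrable std_gaussian (\<lambda>z. f (B t \<omega> + sqrt (u - t) *\<^sub>R z))"
    "(\<integral>d. h (\<omega>, d) \<partial>N2) = (\<integral>z. f (B t \<omega> + sqrt (u - t) *\<^sub>R z) \<partial>std_gaussian)" for \<omega>
    unfolding N2 h_def by (simp_all add: integrable_distr_eq integral_distr)
  have AE_N1: "AE \<omega> in M. P \<omega>" if "AE \<omega> in N1. P \<omega>" for P
    using AE_distrD[OF id that[unfolded N1_def]] .
  have "AE \<omega> in N1. integrable N2 (\<lambda>d. h (\<omega>, d))"
    using N.AE_integrable_fst'[OF int_h] .
  then show "AE \<omega> in M. integrable std_gaussian (\<lambda>z. f (B t \<omega> + sqrt (u - t) *\<^sub>R z))"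
    unfolding transfer by (rule AE_N1)
  define g where "g x = (\<integral>z. f (x + sqrt (u - t) *\<^sub>R z) \<partial>std_gaussian)" for x
  interpret \<gamma>: prob_space "std_gaussian :: (real ^ 'd) measure"
    by (rule prob_space_std_gaussian)
  have g [measurable]: "g \<in> borel_measurable borel"
    unfolding g_def by measurable
  have int_g: "integrable M (\<lambda>\<omega>. g (B t \<omega>))"
  proof -
    have "integrable N1 (\<lambda>\<omega>. \<integral>d. h (\<omega>, d) \<partial>N2)"
      by (rule N.integrable_fst'[OF int_h])
    then show ?thesis
      unfolding transfer(2) g_def[symmetric] N1_def by (subst (asm) integrable_distr_eq) simp_all
  qed
  show "AE \<omega> in M. real_cond_exp M ?F (\<lambda>\<omega>. f (B u \<omega>)) \<omega>
      = (\<integral>z. f (B t \<omega> + sqrt (u - t) *\<^sub>R z) \<partial>std_gaussian)"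
    unfolding g_def[symmetric]
  proof (rule filtration.real_cond_exp_charact[OF _ int int_g])
    fix A assume A [measurable]: "A \<in> sets ?F"
    then have [measurable]: "A \<in> events" using sets_F by auto
    have int_Ah: "integrable (N1 \<Otimes>\<^sub>M N2) (\<lambda>(\<omega>, d). indicator A \<omega> * h (\<omega>, d))"
      by (rule Bochner_Integration.integrable_bound[OF int_h])
         (auto simp: split_beta' indicator_def)
    have "(\<integral>\<omega>\<in>A. f (B u \<omega>) \<partial>M) = (\<integral>\<omega>. (\<lambda>(\<omega>, d). indicator A \<omega> * h (\<omega>, d)) (\<omega>, ?D \<omega>) \<partial>M)"
      by (simp add: set_lebesgue_integral_def h_inc)
    also have "\<dots> = (\<integral>z. (\<lambda>(\<omega>, d). indicator A \<omega> * h (\<omega>, d)) z \<partial>(N1 \<Otimes>\<^sub>M N2))"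
      unfolding joint by (subst integral_distr) simp_all
    also have "\<dots> = (\<integral>\<omega>. (\<integral>d. indicator A \<omega> * h (\<omega>, d) \<partial>N2) \<partial>N1)"
      using N.integral_fst'[OF int_Ah] by simp
    also have "\<dots> = (\<integral>\<omega>. indicator A \<omega> * g (B t \<omega>) \<partial>N1)"
      by (simp add: transfer g_def)
    also have "\<dots> = (\<integral>\<omega>\<in>A. g (B t \<omega>) \<partial>M)"
      unfolding N1_def by (subst integral_distr) (simp_all add: set_lebesgue_integral_def)
    finally show "(\<integral>\<omega>\<in>A. f (B u \<omega>) \<partial>M) = (\<integral>\<omega>\<in>A. g (B t \<omega>) \<partial>M)" .
  qed measurable
qed

lemma subalgebra_augmented_filtration_mono:
  assumes "s \<le> t"
  shows "subalgebra (augmented_filtration M B t) (augmented_filtration M B s)"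
proof -
  let ?G = "\<lambda>t. {B s -` A \<inter> space M | s A. 0 \<le> s \<and> s \<le> t \<and> A \<in> sets borel} \<union> null_sets M"
  have "?G s \<subseteq> ?G t" using assms by (auto intro: order_trans)
  moreover have "?G t \<subseteq> Pow (space M)" for t
    using null_sets_subset_Pow by auto
  ultimately show ?thesis
    unfolding subalgebra_def
    by (simp add: augmented_filtration_def sets_measure_of sigma_sets_mono' del: Un_subset_iff)
qed

text \<open>The exponent uses the rational \<open>r \<ge> t\<close> in place of \<open>t\<close>: by the tower property and Jensen's inequality,
  the left-hand side does not decrease when the conditioning time \<open>t\<close> is replaced by \<open>r\<close>.\<close>

lemma exp_cond_exp_bounded_rational:
  fixes f :: "real ^ 'd \<Rightarrow> real" and n k :: nat
  assumes f [measurable]: "f \<in> borel_measurable borel" and bound: "\<And>x. \<bar>f x\<bar> \<le> C"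
    and k: "0 < k" "k < n" and t: "0 \<le> t" "t \<le> real k / real n"
  defines "r \<equiv> real k / real n"
  shows "(\<integral>\<^sup>+\<omega>. ennreal (exp (real_cond_exp M (augmented_filtration M B t) (\<lambda>\<omega>. f (B 1 \<omega>)) \<omega> / r)) \<partial>M)
    \<le> ennreal (exp (ln (\<integral>a. exp (f a) \<partial>std_gaussian) / r))"
proof -
  let ?Y = "\<lambda>s. real_cond_exp M (augmented_filtration M B s) (\<lambda>\<omega>. f (B 1 \<omega>))"
  have r: "0 < r" "r < 1" using k by (simp_all add: r_def)
  have t_r: "t \<le> r" using t by (simp add: r_def)
  have [measurable]: "B 1 \<in> borel_measurable M" "B r \<in> borel_measurable M"
    using r by (auto intro: measurable_B)
  have int_f: "integrable M (\<lambda>\<omega>. f (B 1 \<omega>))"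
    by (rule integrable_const_bound[of _ C]) (use bound in auto)
  define g where "g x = (\<integral>z. f (x + sqrt (1 - r) *\<^sub>R z) \<partial>std_gaussian)" for x
  interpret \<gamma>: prob_space "std_gaussian :: (real ^ 'd) measure"
    by (rule prob_space_std_gaussian)
  have [measurable]: "g \<in> borel_measurable borel"
    unfolding g_def by measurable
  have Yr: "AE \<omega> in M. ?Y r \<omega> = g (B r \<omega>)"
    unfolding g_def using r by (intro cond_exp_augmented_filtration int_f f) auto
  have g_bound: "\<bar>g x\<bar> \<le> C" for x
  proof -
    have i: "integrable std_gaussian (\<lambda>z. f (x + sqrt (1 - r) *\<^sub>R z))"
      by (rule integrable_std_gaussian_bounded[of _ C]) (simp_all add: bound)
    have b: "- C \<le> f y" "f y \<le> C" for y using bound[of y] by auto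
    have "g x \<le> C" "- C \<le> g x"
      unfolding g_def
      by (rule \<gamma>.integral_le_const[OF i] \<gamma>.integral_ge_const[OF i], simp add: b)+
    then show ?thesis by auto
  qed
  have int_exp_g: "integrable M (\<lambda>\<omega>. exp (g (B r \<omega>) / r))"
    by (rule integrable_const_bound[of _ "exp (C / r)"])
       (use g_bound r in \<open>auto simp: abs_le_iff divide_right_mono\<close>)
  have int_exp: "integrable M (\<lambda>\<omega>. exp (?Y r \<omega> / r))"
  proof (rule integrable_cong_AE_imp[OF int_exp_g])
    show "AE \<omega> in M. exp (g (B r \<omega>) / r) = exp (?Y r \<omega> / r)"
      using Yr by eventually_elim simp
  qed simp
  have int_Y: "integrable M (?Y r)"
    by (rule filtration.real_cond_exp_int(1)[OF int_f])
  have convex: "convex_on UNIV (\<lambda>x. exp (x / r))"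
  proof (rule convex_onI)
    fix a x y :: real assume "0 < a" "a < 1"
    then show "exp (((1 - a) *\<^sub>R x + a *\<^sub>R y) / r) \<le> (1 - a) * exp (x / r) + a * exp (y / r)"
      using convex_onD[OF exp_convex, of a "x / r" "y / r"] by (simp add: add_divide_distrib)
  qed simp
  have "AE \<omega> in M. exp (real_cond_exp M (augmented_filtration M B t) (?Y r) \<omega> / r)
      \<le> real_cond_exp M (augmented_filtration M B t) (\<lambda>\<omega>. exp (?Y r \<omega> / r)) \<omega>"
    by (rule filtration.real_cond_exp_jensens_inequality(2)[where I = UNIV and q = "\<lambda>x. exp (x / r)", OF int_Y _ _ int_exp convex])
       auto
  moreover have "AE \<omega> in M. real_cond_exp M (augmented_filtration M B t) (?Y r) \<omega> = ?Y t \<omega>"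
    by (rule filtration.real_cond_exp_nested_subalg[OF subalgebra_augmented_filtration
          subalgebra_augmented_filtration_mono[OF t_r] int_f])
  ultimately have "AE \<omega> in M. exp (?Y t \<omega> / r) \<le> real_cond_exp M (augmented_filtration M B t) (\<lambda>\<omega>. exp (?Y r \<omega> / r)) \<omega>"
    by eventually_elim simp
  then have "(\<integral>\<^sup>+\<omega>. ennreal (exp (?Y t \<omega> / r)) \<partial>M)
      \<le> (\<integral>\<^sup>+\<omega>. ennreal (real_cond_exp M (augmented_filtration M B t) (\<lambda>\<omega>. exp (?Y r \<omega> / r)) \<omega>) \<partial>M)"
    by (intro nn_integral_mono_AE) (auto intro: ennreal_leI)
  also have "\<dots> = ennreal (\<integral>\<omega>. real_cond_exp M (augmented_filtration M B t) (\<lambda>\<omega>. exp (?Y r \<omega> / r)) \<omega> \<partial>M)"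
    by (intro nn_integral_eq_integral filtration.real_cond_exp_int(1) int_exp filtration.real_cond_exp_pos)
       (use int_exp in auto)
  also have "(\<integral>\<omega>. real_cond_exp M (augmented_filtration M B t) (\<lambda>\<omega>. exp (?Y r \<omega> / r)) \<omega> \<partial>M) = (\<integral>\<omega>. exp (?Y r \<omega> / r) \<partial>M)"
    by (rule filtration.real_cond_exp_int(2)[OF int_exp])
  also have "\<dots> = (\<integral>\<omega>. exp (g (B r \<omega>) / r) \<partial>M)"
    by (rule integral_cong_AE) (use Yr in auto)
  also have "\<dots> = (\<integral>x. exp (g x / r) \<partial>distr M borel (B r))"
    by (subst integral_distr) auto
  also have "\<dots> = (\<integral>a. exp (g (sqrt r *\<^sub>R a) / r) \<partial>std_gaussian)"
    unfolding distr_marginal[OF r(1)] by (subst integral_distr) auto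
  also have "ennreal \<dots> \<le> ennreal (exp (ln (\<integral>a. exp (f a) \<partial>std_gaussian) / r))"
    unfolding g_def r_def
    by (intro ennreal_leI exp_hypercontractivity_rational[OF f bound]) (use k in auto)
  finally show ?thesis .
qed

end

section \<open>Passage to real times and unbounded functions\<close>

lemma rationals_from_above:
  fixes t :: real
  assumes "0 \<le> t" "t < 1"
  obtains k n :: "nat \<Rightarrow> nat" where "\<And>m. 0 < k m" "\<And>m. k m < n m" "\<And>m. t \<le> real (k m) / real (n m)"
    "(\<lambda>m. real (k m) / real (n m)) \<longlonglongrightarrow> t"
proof -
  define e where "e m = (1 - t) / real (Suc m)" for m
  have e: "0 < e m" "e m \<le> 1 - t" for m
  proof -
    have "(1 - t) / real (Suc m) \<le> (1 - t) / 1"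
      using assms by (intro frac_le) auto
    then show "0 < e m" "e m \<le> 1 - t" using assms by (simp_all add: e_def)
  qed
  have "\<exists>k n :: nat. 0 < k \<and> k < n \<and> t \<le> real k / real n \<and> real k / real n < t + e m" for m
  proof -
    obtain q where q: "q \<in> \<rat>" "t < q" "q < t + e m"
      using Rats_dense_in_real[of t "t + e m"] e[of m] by auto
    have "0 < q" "q < 1" using q assms e[of m] by auto
    then obtain k n :: nat where kn: "n \<noteq> 0" "\<bar>q\<bar> = real k / real n"
      using Rats_abs_nat_div_natE[OF q(1)] by metis
    then have eq: "q = real k / real n" using \<open>0 < q\<close> by simp
    have "0 < k" "k < n"
      using kn(1) \<open>0 < q\<close> \<open>q < 1\<close> by (auto simp: eq field_simps intro: gr0I)
    then show ?thesis using q eq by (intro exI[of _ k] exI[of _ n]) auto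
  qed
  then obtain k n :: "nat \<Rightarrow> nat" where kn: "\<And>m. 0 < k m" "\<And>m. k m < n m"
    "\<And>m. t \<le> real (k m) / real (n m)" "\<And>m. real (k m) / real (n m) < t + e m"
    by metis
  have "e \<longlonglongrightarrow> 0"
    using LIMSEQ_Suc[OF lim_const_over_n[of "1 - t"]] by (simp add: e_def[abs_def])
  then have "(\<lambda>m. t + e m) \<longlonglongrightarrow> t" using tendsto_add[OF tendsto_const] by force
  then have "(\<lambda>m. real (k m) / real (n m)) \<longlonglongrightarrow> t"
    by (rule tendsto_sandwich[OF _ _ tendsto_const, rotated 2])
       (use kn in \<open>auto intro!: always_eventually less_imp_le\<close>)
  with kn show ?thesis by (intro that)
qed

lemma truncation_tendsto:
  fixes x :: real
  shows "(\<lambda>m. max (- real m) (min (real m) x)) \<longlonglongrightarrow> x"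
proof (rule tendsto_eventually)
  have "\<forall>\<^sub>F m in sequentially. \<bar>x\<bar> \<le> real m"
    using filterlim_real_sequentially by (simp add: filterlim_at_top)
  then show "\<forall>\<^sub>F m in sequentially. max (- real m) (min (real m) x) = x"
    by eventually_elim auto
qed

theorem proposition3p2:
  fixes M :: "'w measure"
    and B :: "real \<Rightarrow> 'w \<Rightarrow> real ^ 'd::finite"
    and f :: "real ^ 'd \<Rightarrow> real"
    and t :: real
  assumes "standard_brownian_motion M B"
    and "f \<in> borel_measurable borel"
    and "integrable std_gaussian (\<lambda>x. exp (f x))"
    and "integrable std_gaussian f"
    and "0 < t" and "t \<le> 1"
  shows "integrable M (\<lambda>\<omega>. exp (inverse t *
             real_cond_exp M (augmented_filtration M B t) (\<lambda>\<omega>'. f (B 1 \<omega>')) \<omega>))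
       \<and> t * ln (\<integral>\<omega>. exp (inverse t *
             real_cond_exp M (augmented_filtration M B t) (\<lambda>\<omega>'. f (B 1 \<omega>')) \<omega>) \<partial>M)
         \<le> ln (\<integral>\<omega>. exp (f (B 1 \<omega>)) \<partial>M)"
proof -
  interpret standard_brownian_motion M B by fact
  interpret \<gamma>: prob_space "std_gaussian :: (real ^ 'd) measure"
    by (rule prob_space_std_gaussian)
  note f [measurable] = assms(2)
  have B_meas [measurable]: "B 1 \<in> borel_measurable M" "B t \<in> borel_measurable M"
    using \<open>0 < t\<close> by (auto intro: measurable_B)
  have law1: "distr M borel (B 1) = distr std_gaussian borel (\<lambda>x. x)"
    using distr_marginal[of 1] by simp
  have int1: "integrable M (\<lambda>\<omega>. h (B 1 \<omega>)) \<longleftrightarrow> integrable std_gaussian h"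
    and lint1: "(\<integral>\<omega>. h (B 1 \<omega>) \<partial>M) = (\<integral>x. h x \<partial>std_gaussian)"
    if [measurable]: "h \<in> borel_measurable borel" for h :: "real ^ 'd \<Rightarrow> real"
  proof -
    have "integrable M (\<lambda>\<omega>. h (B 1 \<omega>)) \<longleftrightarrow> integrable (distr M borel (B 1)) h"
      by (simp add: integrable_distr_eq)
    then show "integrable M (\<lambda>\<omega>. h (B 1 \<omega>)) \<longleftrightarrow> integrable std_gaussian h"
      by (simp add: law1 integrable_distr_eq)
    have "(\<integral>\<omega>. h (B 1 \<omega>) \<partial>M) = (\<integral>x. h x \<partial>distr M borel (B 1))"
      by (simp add: integral_distr)
    then show "(\<integral>\<omega>. h (B 1 \<omega>) \<partial>M) = (\<integral>x. h x \<partial>std_gaussian)"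
      by (simp add: law1 integral_distr)
  qed
  let ?Y = "\<lambda>h. real_cond_exp M (augmented_filtration M B t) (\<lambda>\<omega>. h (B 1 \<omega>))"
  let ?I = "\<integral>x. exp (f x) \<partial>std_gaussian"
  have I_pos: "0 < ?I"
    using assms(3) by (intro \<gamma>.expectation_greater) simp_all
  have int_f: "integrable M (\<lambda>\<omega>. f (B 1 \<omega>))"
    by (simp add: int1 assms(4))
  show ?thesis
  proof (cases "t = 1")
    case True
    have "AE \<omega> in M. ?Y f \<omega> = f (B 1 \<omega>)"
      unfolding True by (intro filtration.real_cond_exp_F_meas int_f measurable_compose[OF _ f] measurable_augmented_filtration) auto
    then have ae: "AE \<omega> in M. exp (?Y f \<omega>) = exp (f (B 1 \<omega>))" by eventually_elim simp
    have "integrable M (\<lambda>\<omega>. exp (f (B 1 \<omega>)))" by (simp add: int1[of "\<lambda>x. exp (f x)"] assms(3))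
    then have "integrable M (\<lambda>\<omega>. exp (?Y f \<omega>))"
      by (rule integrable_cong_AE_imp) (use ae in auto)
    moreover have "(\<integral>\<omega>. exp (?Y f \<omega>) \<partial>M) = (\<integral>\<omega>. exp (f (B 1 \<omega>)) \<partial>M)"
      by (rule integral_cong_AE) (use ae in auto)
    ultimately show ?thesis using True by simp
  next
    case False
    with assms have t: "0 < t" "t < 1" by auto
    obtain k n where k: "\<And>m. 0 < k m" "\<And>m. k m < n m" and r_ge: "\<And>m. t \<le> real (k m) / real (n m)"
      and r_lim: "(\<lambda>m. real (k m) / real (n m)) \<longlonglongrightarrow> t"
      by (rule rationals_from_above[of t]) (use t in auto)
    define r where "r m = real (k m) / real (n m)" for m
    have r_tendsto: "r \<longlonglongrightarrow> t" using r_lim by (simp add: r_def[abs_def])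
    define F where "F m x = max (- real m) (min (real m) (f x))" for m x
    have F_meas [measurable]: "F m \<in> borel_measurable borel" for m
      unfolding F_def by measurable
    have F_bound: "\<bar>F m x\<bar> \<le> real m" and F_le: "\<bar>F m x\<bar> \<le> \<bar>f x\<bar>" and F_exp: "exp (F m x) \<le> exp (f x) + 1" for m x
    proof -
      show "\<bar>F m x\<bar> \<le> real m" "\<bar>F m x\<bar> \<le> \<bar>f x\<bar>" by (auto simp: F_def)
      have "F m x \<le> max 0 (f x)" by (auto simp: F_def)
      then have "exp (F m x) \<le> exp (max 0 (f x))" by simp
      also have "\<dots> \<le> exp (f x) + 1" by (simp add: max_def)
      finally show "exp (F m x) \<le> exp (f x) + 1" .
    qed
    have F_lim: "(\<lambda>m. F m x) \<longlonglongrightarrow> f x" for x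
      unfolding F_def by (rule truncation_tendsto)
    have int_F: "integrable M (\<lambda>\<omega>. F m (B 1 \<omega>))" for m
      by (rule integrable_const_bound[of _ "real m"]) (use F_bound in auto)
    \<comment> \<open>The Gaussian kernel reduces the convergence of the conditional expectations to dominated convergence.\<close>
    have "AE \<omega> in M. \<forall>m. ?Y (F m) \<omega> = (\<integral>z. F m (B t \<omega> + sqrt (1 - t) *\<^sub>R z) \<partial>std_gaussian)"
      unfolding AE_all_countable using t by (intro allI cond_exp_augmented_filtration int_F F_meas) auto
    moreover have "AE \<omega> in M. ?Y f \<omega> = (\<integral>z. f (B t \<omega> + sqrt (1 - t) *\<^sub>R z) \<partial>std_gaussian)"
      using t by (intro cond_exp_augmented_filtration int_f f) auto
    moreover have "AE \<omega> in M. integrable std_gaussian (\<lambda>z. f (B t \<omega> + sqrt (1 - t) *\<^sub>R z))"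
      using t by (intro cond_exp_augmented_filtration int_f f) auto
    ultimately have Y_lim: "AE \<omega> in M. (\<lambda>m. ?Y (F m) \<omega>) \<longlonglongrightarrow> ?Y f \<omega>"
    proof eventually_elim
      case (elim \<omega>)
      have "(\<lambda>m. \<integral>z. F m (B t \<omega> + sqrt (1 - t) *\<^sub>R z) \<partial>std_gaussian)
          \<longlonglongrightarrow> (\<integral>z. f (B t \<omega> + sqrt (1 - t) *\<^sub>R z) \<partial>std_gaussian)"
        by (rule integral_dominated_convergence[where w = "\<lambda>z. \<bar>f (B t \<omega> + sqrt (1 - t) *\<^sub>R z)\<bar>"])
           (use elim in \<open>auto simp: F_lim F_le\<close>)
      then show ?case using elim by simp
    qed
    have rhs_lim: "(\<lambda>m. exp (ln (\<integral>x. exp (F m x) \<partial>std_gaussian) / r m)) \<longlonglongrightarrow> exp (ln ?I / t)"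
    proof -
      have "(\<lambda>m. \<integral>x. exp (F m x) \<partial>std_gaussian) \<longlonglongrightarrow> ?I"
        by (rule integral_dominated_convergence[where w = "\<lambda>x. exp (f x) + 1"])
           (use assms(3) in \<open>auto intro!: tendsto_exp F_lim F_exp\<close>)
      then show ?thesis
        using I_pos t r_tendsto by (intro tendsto_exp tendsto_divide tendsto_ln) auto
    qed
    have "AE \<omega> in M. (\<lambda>m. exp (?Y (F m) \<omega> / r m)) \<longlonglongrightarrow> exp (?Y f \<omega> / t)"
      using Y_lim by eventually_elim (use t r_tendsto in \<open>auto intro!: tendsto_exp tendsto_divide\<close>)
    then have "(\<integral>\<^sup>+\<omega>. ennreal (exp (?Y f \<omega> / t)) \<partial>M) = (\<integral>\<^sup>+\<omega>. liminf (\<lambda>m. ennreal (exp (?Y (F m) \<omega> / r m))) \<partial>M)"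
    proof (intro nn_integral_cong_AE, eventually_elim)
      case (elim \<omega>)
      show ?case
        by (rule lim_imp_Liminf[symmetric]) (simp_all add: tendsto_ennrealI elim)
    qed
    also have "\<dots> \<le> liminf (\<lambda>m. \<integral>\<^sup>+\<omega>. ennreal (exp (?Y (F m) \<omega> / r m)) \<partial>M)"
      by (rule nn_integral_liminf) measurable
    also have "\<dots> \<le> liminf (\<lambda>m. ennreal (exp (ln (\<integral>x. exp (F m x) \<partial>std_gaussian) / r m)))"
      unfolding r_def using t
      by (intro Liminf_mono always_eventually allI exp_cond_exp_bounded_rational[OF F_meas F_bound k _ r_ge]) auto
    also have "\<dots> = ennreal (exp (ln ?I / t))"
      by (rule lim_imp_Liminf) (simp_all add: tendsto_ennrealI rhs_lim)
    finally have bound: "(\<integral>\<^sup>+\<omega>. ennreal (exp (?Y f \<omega> / t)) \<partial>M) \<le> ennreal (exp (ln ?I / t))" .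
    have int_Y: "integrable M (\<lambda>\<omega>. exp (?Y f \<omega> / t))"
      by (rule integrableI_nonneg) (use bound in \<open>auto intro: le_less_trans\<close>)
    have le: "(\<integral>\<omega>. exp (?Y f \<omega> / t) \<partial>M) \<le> exp (ln ?I / t)"
      using bound by (simp add: nn_integral_eq_integral[OF int_Y])
    have pos: "0 < (\<integral>\<omega>. exp (?Y f \<omega> / t) \<partial>M)"
      using int_Y by (intro expectation_greater) simp_all
    have "ln (\<integral>\<omega>. exp (?Y f \<omega> / t) \<partial>M) \<le> ln ?I / t"
      using ln_le_cancel_iff[OF pos exp_gt_zero, of "ln ?I / t"] le by simp
    then have "t * ln (\<integral>\<omega>. exp (?Y f \<omega> / t) \<partial>M) \<le> ln ?I"
      using t by (simp add: field_simps)
    then show ?thesis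
      using int_Y lint1[of "\<lambda>x. exp (f x)"] by (simp add: divide_inverse mult.commute)
  qed
qed

end
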